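(* Let $\Sigma$ be a smooth fan with $n$ rays and let $\mathfrak v:A\to\mathcal O_\Sigma$ be a valuation corresponding to a toric flat sheaf of algebras on $Y(\Sigma)$. The pair $(A,\mathfrak v)$ has a finite strong Khovanskii basis if and only if the strong Khovanskii basis algorithm (described in the context) applied to $(A,\mathfrak v)$ stops, i.e. completes its $n$ rounds in finite time.
   Context: $\mathbf k$ is algebraically closed, $\Sigma$ a smooth fan in $N_{\mathbb Q}$ ($N$ a lattice, $M=\operatorname{Hom}(N,\mathbb Z)$) with primitive ray generators $\rho_1,\dots,\rho_n$; $\mathcal O_\Sigma$ is the semifield of integral piecewise linear functions on $|\Sigma|$ under $\min,+$ (with $\infty$ adjoined); $A$ is a finitely generated positively graded $\mathbf k$-domain. A valuation satisfies $\mathfrak v(fg)=\mathfrak v(f)+\mathfrak v(g)$, $\mathfrak v(f+g)\ge\min\{\mathfrak v(f),\mathfrak v(g)\}$, $\mathfrak v(c)=0$ for $0\neq c\in\mathbf k$, $\mathfrak v(0)=\infty$. It corresponds to a toric flat sheaf of algebras on $Y(\Sigma)$ if it is homogeneous ($\mathfrak v(\sum f_m)=\min\mathfrak v(f_m)$ for $f_m$ in distinct graded pieces) and for each $\sigma\in\Sigma$ there is a vector space basis $\mathbb B_\sigma$ of $A$ with $\mathfrak v(\sum C_bb)|_\sigma=\min\{\mathfrak v(b)|_\sigma:C_b\ne0\}$ and each $\mathfrak v(b)|_\sigma$ the restriction of an element of $M$. Put $\mathfrak v_i(f)=\mathfrak v(f)(\rho_i)$. For $0\le j\le n$ and $\mathbf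 r\in\mathbb Z^j$ let $F^j_{\mathbf r}=\{f\in A:\mathfrak v_i(f)\ge r_i,\ 1\le i\le j\}$, $T_j=\mathbf k[t_1^{\pm1},\dots,t_j^{\pm1}]$, and $R_j=\bigoplus_{\mathbf r\in\mathbb Z^j}F^j_{\mathbf r}t^{\mathbf r}\subset A\otimes_{\mathbf k}T_j$; so $R_0=A$ and $R_n=\mathcal R(A,\hat{\mathfrak v})$ is the total section ring. $\mathfrak v_{j+1}$ extends to $A\otimes T_j$ by $\mathfrak v_{j+1}(\sum f_{\mathbf r}t^{\mathbf r})=\min\mathfrak v_{j+1}(f_{\mathbf r})$, hence to $R_j$, and $R_{j+1}$ is the Rees algebra of $(R_j,\mathfrak v_{j+1})$. A finite set $\mathcal B\subset A$ is a strong Khovanskii basis if it is the image under $t_i\mapsto1$ of a ($\mathbb Z^n$-homogeneous) generating set of $\mathcal R(A,\hat{\mathfrak v})$ as an algebra over $\mathbf k[t_1^{-1},\dots,t_n^{-1}]$. Subroutine (Kaveh–Manon Khovanskii basis algorithm): given a finitely generated algebra $R$ with a valuation $\mathfrak w:R\to\mathbb Z\cup\{\infty\}$ and a finite generating set of $R$, it enlarges the generating set step by step to a finite Khovanskii basis (a set whose classes generate the associated graded algebra $\operatorname{gr}_{\mathfrak w}(R)$); it terminates in finite time if and only if $(R,\mathfrak w)$ has a finite Khovanskii basis. Strong Khovanskii basis algorithm: set $R_0=A$ with a finite generating set $\mathcal B_0$. For $j=0,1,\dots,n-1$: (1) from the generating set $\mathcal B_j\subset R_j$ use the subroutine to construct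 a finite Khovanskii basis $\mathcal B_j'$ of $(R_j,\mathfrak v_{j+1})$; (2) set $\mathcal B_{j+1}=\{b\otimes t_{j+1}^{\mathfrak v_{j+1}(b)}:b\in\mathcal B_j'\}\cup\{t_{j+1}^{-1}\}\subset R_{j+1}$ and continue.
   Formalization: The initial finite generating set of A is assumed homogeneous, and the subroutine is assumed to add only homogeneous elements when given homogeneous generators and a homogeneous valuation; otherwise the set produced by a round need not generate the next Rees algebra. *)

theory Defs
  imports
    "HOL-Analysis.Analysis"
    "HOL-Library.Poly_Mapping"
    "HOL-Computational_Algebra.Polynomial"
    "HOL-Algebra.QuotRing"
    "HOL-Algebra.Generated_Rings"
begin

text \<open>
  Values in $\mathbb{Z}\cup\{\infty\}$ and in $\mathbb{Q}\cup\{\infty\}$ are taken in \<^typ>\<open>ereal\<close>,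
  integrality (and the absence of $-\infty$) being imposed separately. A minimum over a finite
  family is written as an infimum, so that the minimum of the empty family is $\infty$, the value
  at 0.
\<close>

section \<open>Algebras, valuations and Khovanskii bases\<close>

text \<open>The subalgebra generated by \<open>B\<close> over the ring of scalars \<open>K\<close> (a subset of the same ring).\<close>

inductive_set alg_gen :: "'r::comm_ring_1 set \<Rightarrow> 'r set \<Rightarrow> 'r set"
  for K :: "'r set" and B :: "'r set" where
  one: "1 \<in> alg_gen K B"
| scalar: "c \<in> K \<Longrightarrow> c \<in> alg_gen K B"
| gen: "b \<in> B \<Longrightarrow> b \<in> alg_gen K B"
| minus: "x \<in> alg_gen K B \<Longrightarrow> - x \<in> alg_gen K B"
| add: "x \<in> alg_gen K B \<Longrightarrow> y \<in> alg_gen K B \<Longrightarrow> x + y \<in> alg_gen K B"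
| mult: "x \<in> alg_gen K B \<Longrightarrow> y \<in> alg_gen K B \<Longrightarrow> x * y \<in> alg_gen K B"

definition int_valuation :: "'r::comm_ring_1 set \<Rightarrow> 'r set \<Rightarrow> ('r \<Rightarrow> ereal) \<Rightarrow> bool" where
  "int_valuation K R w \<longleftrightarrow>
     (\<forall>f\<in>R. w f = \<infinity> \<or> (\<exists>z::int. w f = ereal (of_int z))) \<and>
     (\<forall>f\<in>R. \<forall>g\<in>R. w (f * g) = w f + w g) \<and>
     (\<forall>f\<in>R. \<forall>g\<in>R. w (f + g) \<ge> min (w f) (w g)) \<and>
     (\<forall>c\<in>K. c \<noteq> 0 \<longrightarrow> w c = 0) \<and>
     w 0 = \<infinity>"

text \<open>
  The associated graded algebra $\bigoplus_{c\in\mathbb{Z}} F_{\ge c}/F_{>c}$, where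
  $F_{\ge c}=\{f\in R: w(f)\ge c\}$ and $F_{>c}=\{f\in R: w(f)>c\}$, is realised as
  $(\bigoplus_c F_{\ge c})/(\bigoplus_c F_{>c})$. Elements of the direct sums are finitely supported
  functions on $\mathbb{Z}$; their (convolution) product is the one of \<^typ>\<open>int \<Rightarrow>\<^sub>0 'r\<close>.
\<close>

definition filtration_ring :: "'r::comm_ring_1 set \<Rightarrow> ('r \<Rightarrow> ereal) \<Rightarrow> (int \<Rightarrow>\<^sub>0 'r) ring" where
  "filtration_ring R w =
     \<lparr>carrier = {g. \<forall>c. Poly_Mapping.lookup g c \<in> R \<and> ereal (of_int c) \<le> w (Poly_Mapping.lookup g c)},
      mult = (*), one = 1, zero = 0, add = (+)\<rparr>"

definition filtration_ideal :: "'r::comm_ring_1 set \<Rightarrow> ('r \<Rightarrow> ereal) \<Rightarrow> (int \<Rightarrow>\<^sub>0 'r) set" where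
  "filtration_ideal R w = {g. \<forall>c. Poly_Mapping.lookup g c \<in> R \<and> ereal (of_int c) < w (Poly_Mapping.lookup g c)}"

definition gr :: "'r::comm_ring_1 set \<Rightarrow> ('r \<Rightarrow> ereal) \<Rightarrow> (int \<Rightarrow>\<^sub>0 'r) set ring" where
  "gr R w = filtration_ring R w Quot filtration_ideal R w"

text \<open>
  The class of \<open>b\<close> in degree \<open>w b\<close>. If \<open>w b = \<infinity>\<close>, the degree used is the dummy value 0 and the
  class is zero.
\<close>

definition gr_class :: "'r::comm_ring_1 set \<Rightarrow> ('r \<Rightarrow> ereal) \<Rightarrow> 'r \<Rightarrow> (int \<Rightarrow>\<^sub>0 'r) set" where
  "gr_class R w b =
     filtration_ideal R w +>\<^bsub>filtration_ring R w\<^esub> Poly_Mapping.single \<lfloor>real_of_ereal (w b)\<rfloor> b"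

text \<open>
  Scalars have value 0 (or are 0), so \<open>gr_class R w ` K\<close> is the image of \<open>K\<close> in degree 0 of
  \<open>gr R w\<close>.
\<close>

definition khovanskii_basis :: "'r::comm_ring_1 set \<Rightarrow> 'r set \<Rightarrow> ('r \<Rightarrow> ereal) \<Rightarrow> 'r set \<Rightarrow> bool" where
  "khovanskii_basis K R w B \<longleftrightarrow>
     B \<subseteq> R \<and>
     generate_ring (gr R w) (gr_class R w ` K \<union> gr_class R w ` B) = carrier (gr R w)"

text \<open>
  The Khovanskii basis algorithm is a procedure whose elementary step \<open>step R w\<close> enlarges a finite
  generating set; it is iterated until a Khovanskii basis is reached. \<open>None\<close> means that this never
  happens.
\<close>

definition subroutine_result ::
    "'r::comm_ring_1 set \<Rightarrow> ('r set \<Rightarrow> ('r \<Rightarrow> ereal) \<Rightarrow> 'r set \<Rightarrow> 'r set) \<Rightarrow>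
     'r set \<Rightarrow> ('r \<Rightarrow> ereal) \<Rightarrow> 'r set \<Rightarrow> 'r set option" where
  "subroutine_result K step R w B =
     (if \<exists>k. khovanskii_basis K R w ((step R w ^^ k) B)
      then Some ((step R w ^^ (LEAST k. khovanskii_basis K R w ((step R w ^^ k) B))) B)
      else None)"


section \<open>Fans and piecewise linear functions\<close>

locale rational_lattice = vector_space scaleQ
  for scaleQ :: "rat \<Rightarrow> 'v::ab_group_add \<Rightarrow> 'v" +
  fixes N :: "'v set"
  assumes lattice_ex:
    "\<exists>E. finite E \<and> independent E \<and> span E = UNIV \<and>
         N = range (\<lambda>c::'v \<Rightarrow> int. \<Sum>e\<in>E. scaleQ (of_int (c e)) e)"
begin

definition lattice_basis :: "'v set \<Rightarrow> bool" where
  "lattice_basis E \<longleftrightarrow>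
     finite E \<and> independent E \<and> span E = UNIV \<and>
     N = range (\<lambda>c::'v \<Rightarrow> int. \<Sum>e\<in>E. scaleQ (of_int (c e)) e)"

text \<open>$M=\operatorname{Hom}(N,\mathbb{Z})$, its elements being extended linearly to $N_{\mathbb{Q}}$.\<close>

definition dual_lattice :: "('v \<Rightarrow> rat) set" where
  "dual_lattice = {m. Vector_Spaces.linear scaleQ (*) m \<and> (\<forall>u\<in>N. m u \<in> \<int>)}"

definition cone_over :: "'v set \<Rightarrow> 'v set" where
  "cone_over S = {\<Sum>s\<in>S. scaleQ (c s) s | c. \<forall>s\<in>S. 0 \<le> c s}"

definition polyhedral_cone :: "'v set \<Rightarrow> bool" where
  "polyhedral_cone \<sigma> \<longleftrightarrow> (\<exists>S. finite S \<and> S \<subseteq> N \<and> \<sigma> = cone_over S)"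

definition strongly_convex :: "'v set \<Rightarrow> bool" where
  "strongly_convex \<sigma> \<longleftrightarrow> (\<forall>x. x \<in> \<sigma> \<and> - x \<in> \<sigma> \<longrightarrow> x = 0)"

definition face_of_cone :: "'v set \<Rightarrow> 'v set \<Rightarrow> bool" where
  "face_of_cone \<tau> \<sigma> \<longleftrightarrow>
     (\<exists>m. Vector_Spaces.linear scaleQ (*) m \<and> (\<forall>x\<in>\<sigma>. 0 \<le> m x) \<and> \<tau> = {x\<in>\<sigma>. m x = (0::rat)})"

definition fan :: "'v set set \<Rightarrow> bool" where
  "fan \<Sigma> \<longleftrightarrow>
     finite \<Sigma> \<and>
     (\<forall>\<sigma>\<in>\<Sigma>. polyhedral_cone \<sigma> \<and> strongly_convex \<sigma>) \<and>
     (\<forall>\<sigma>\<in>\<Sigma>. \<forall>\<tau>. face_of_cone \<tau> \<sigma> \<longrightarrow> \<tau> \<in> \<Sigma>) \<and>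
     (\<forall>\<sigma>\<in>\<Sigma>. \<forall>\<tau>\<in>\<Sigma>. face_of_cone (\<sigma> \<inter> \<tau>) \<sigma> \<and> face_of_cone (\<sigma> \<inter> \<tau>) \<tau>)"

definition smooth_cone :: "'v set \<Rightarrow> bool" where
  "smooth_cone \<sigma> \<longleftrightarrow> (\<exists>E S. lattice_basis E \<and> S \<subseteq> E \<and> \<sigma> = cone_over S)"

definition smooth_fan :: "'v set set \<Rightarrow> bool" where
  "smooth_fan \<Sigma> \<longleftrightarrow> fan \<Sigma> \<and> (\<forall>\<sigma>\<in>\<Sigma>. smooth_cone \<sigma>)"

definition rays :: "'v set set \<Rightarrow> 'v set set" where
  "rays \<Sigma> = {\<tau>\<in>\<Sigma>. dim \<tau> = 1}"

definition primitive :: "'v \<Rightarrow> bool" where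
  "primitive u \<longleftrightarrow> u \<in> N \<and> (\<forall>w\<in>N. \<forall>k::nat. u = scaleQ (of_nat k) w \<longrightarrow> k = 1)"

text \<open>
  Membership in $\mathcal{O}_\Sigma$: integral piecewise linear functions on $|\Sigma|$ (the
  cones of linearity need not be cones of $\Sigma$), together with the constant $\infty$. Values
  outside $|\Sigma|$ are irrelevant.
\<close>

definition PL_semifield :: "'v set set \<Rightarrow> ('v \<Rightarrow> ereal) set" where
  "PL_semifield \<Sigma> =
     {\<phi>. (\<forall>x\<in>\<Union>\<Sigma>. \<phi> x = \<infinity>) \<or>
         (\<exists>\<C>. finite \<C> \<and> (\<forall>\<tau>\<in>\<C>. polyhedral_cone \<tau>) \<and> \<Union>\<C> = \<Union>\<Sigma> \<and>
              (\<forall>\<tau>\<in>\<C>. \<exists>m\<in>dual_lattice. \<forall>x\<in>\<tau>. \<phi> x = ereal (of_rat (m x))))}"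

end


section \<open>Positively graded domains and their Laurent polynomial rings\<close>

text \<open>
  $A\otimes_{\mathbf k}\mathbf k[t_1^{\pm1},t_2^{\pm1},\dots]$: the Laurent polynomial
  $\sum_{\mathbf r} f_{\mathbf r}t^{\mathbf r}$ is the finitely supported function
  $\mathbf r\mapsto f_{\mathbf r}$. All the rings $A\otimes T_j$ live in this one type.
\<close>

type_synonym 'a laurent = "(nat \<Rightarrow>\<^sub>0 int) \<Rightarrow>\<^sub>0 'a"

definition tpow :: "nat \<Rightarrow> int \<Rightarrow> 'a::idom laurent" where
  "tpow i z = Poly_Mapping.single (Poly_Mapping.single i z) 1"

definition eval_one :: "'a::idom laurent \<Rightarrow> 'a" where
  "eval_one p = (\<Sum>r\<in>Poly_Mapping.keys p. Poly_Mapping.lookup p r)"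

locale graded_domain = vector_space scaleA
  for scaleA :: "'k::alg_closed_field \<Rightarrow> 'a::idom \<Rightarrow> 'a" +
  fixes Agr :: "nat \<Rightarrow> 'a set"
  assumes scale_mult: "scaleA c (x * y) = scaleA c x * y"
    and fin_gen: "\<exists>B. finite B \<and> alg_gen (range (\<lambda>c. scaleA c 1)) B = UNIV"
    and graded_subspace: "subspace (Agr m)"
    and graded_sum: "\<exists>!g :: nat \<Rightarrow>\<^sub>0 'a. (\<forall>m. Poly_Mapping.lookup g m \<in> Agr m) \<and> f = (\<Sum>m\<in>Poly_Mapping.keys g. Poly_Mapping.lookup g m)"
    and graded_mult: "x \<in> Agr l \<Longrightarrow> y \<in> Agr m \<Longrightarrow> x * y \<in> Agr (l + m)"
    and graded_zero: "Agr 0 = range (\<lambda>c. scaleA c 1)"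
begin

definition scalars :: "'a laurent set" where
  "scalars = range (\<lambda>c. Poly_Mapping.single 0 (scaleA c 1))"

text \<open>Homogeneity for the grading of $A\otimes T_j$ by $\mathbb{N}\times\mathbb{Z}^j$.\<close>

definition homogeneous :: "'a laurent \<Rightarrow> bool" where
  "homogeneous p \<longleftrightarrow> (\<exists>m r. \<exists>f\<in>Agr m. p = Poly_Mapping.single r f)"

definition homogeneous_valuation :: "'a laurent set \<Rightarrow> ('a laurent \<Rightarrow> ereal) \<Rightarrow> bool" where
  "homogeneous_valuation R w \<longleftrightarrow>
     (\<forall>D :: (nat \<times> (nat \<Rightarrow>\<^sub>0 int)) set. \<forall>f.
        finite D \<and> (\<forall>(m, r)\<in>D. f (m, r) \<in> Agr m \<and> Poly_Mapping.single r (f (m, r)) \<in> R) \<longrightarrow>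
        w (\<Sum>(m, r)\<in>D. Poly_Mapping.single r (f (m, r))) =
          (INF (m, r)\<in>D. w (Poly_Mapping.single r (f (m, r)))))"

text \<open>
  The contract of the Khovanskii basis algorithm for finitely generated subalgebras of the Laurent
  polynomial ring. The last but one conjunct says that the algorithm respects the grading: with
  homogeneous generators of a ring with a homogeneous valuation, only homogeneous elements are added.
  (For inhomogeneous generators the next round need not receive a generating set: in
  $\mathbf k[x]$ with the order at 0, the Khovanskii basis $\{1-x, x(x-1)\}$ generates, but
  $1-x$, $x(x-1)t$, $t^{-1}$ do not generate the Rees algebra.)
\<close>

definition khovanskii_subroutine ::
    "('a laurent set \<Rightarrow> ('a laurent \<Rightarrow> ereal) \<Rightarrow> 'a laurent set \<Rightarrow> 'a laurent set) \<Rightarrow> bool" where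
  "khovanskii_subroutine step \<longleftrightarrow>
     (\<forall>R w B. finite B \<and> alg_gen scalars B = R \<and> int_valuation scalars R w \<longrightarrow>
        finite (step R w B) \<and> B \<subseteq> step R w B \<and> step R w B \<subseteq> R \<and>
        (homogeneous_valuation R w \<and> (\<forall>b\<in>B. homogeneous b) \<longrightarrow>
           (\<forall>b\<in>step R w B. homogeneous b)) \<and>
        (subroutine_result scalars step R w B \<noteq> None \<longleftrightarrow>
           (\<exists>B'. finite B' \<and> khovanskii_basis scalars R w B')))"

end


section \<open>Toric flat valuations and the strong Khovanskii basis algorithm\<close>

locale toric_flat_valuation =
  L: rational_lattice scaleQ N + A: graded_domain scaleA Agr
  for scaleQ :: "rat \<Rightarrow> 'v::ab_group_add \<Rightarrow> 'v" and N :: "'v set"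
    and scaleA :: "'k::alg_closed_field \<Rightarrow> 'a::idom \<Rightarrow> 'a" and Agr :: "nat \<Rightarrow> 'a set" +
  fixes \<Sigma> :: "'v set set" and n :: nat and \<rho> :: "nat \<Rightarrow> 'v"
    and v :: "'a \<Rightarrow> 'v \<Rightarrow> ereal"
  assumes smooth: "L.smooth_fan \<Sigma>"
    and primitive_gens: "i \<in> {1..n} \<Longrightarrow> L.primitive (\<rho> i)"
    and ray_gens: "bij_betw (\<lambda>i. L.cone_over {\<rho> i}) {1..n} (L.rays \<Sigma>)"
    and val_PL: "v f \<in> L.PL_semifield \<Sigma>"
    and val_mult: "x \<in> \<Union>\<Sigma> \<Longrightarrow> v (f * g) x = v f x + v g x"
    and val_add: "x \<in> \<Union>\<Sigma> \<Longrightarrow> v (f + g) x \<ge> min (v f x) (v g x)"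
    and val_scalar: "c \<noteq> 0 \<Longrightarrow> x \<in> \<Union>\<Sigma> \<Longrightarrow> v (scaleA c 1) x = 0"
    and val_zero: "x \<in> \<Union>\<Sigma> \<Longrightarrow> v 0 x = \<infinity>"
    and val_homogeneous:
      "finite D \<Longrightarrow> (\<And>m. m \<in> D \<Longrightarrow> h m \<in> Agr m) \<Longrightarrow> x \<in> \<Union>\<Sigma> \<Longrightarrow>
         v (\<Sum>m\<in>D. h m) x = (INF m\<in>D. v (h m) x)"
    and adapted_bases:
      "\<sigma> \<in> \<Sigma> \<Longrightarrow>
         \<exists>\<B>. A.independent \<B> \<and> A.span \<B> = UNIV \<and>
             (\<forall>D C. finite D \<and> D \<subseteq> \<B> \<and> (\<forall>b\<in>D. C b \<noteq> 0) \<longrightarrow>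
                (\<forall>x\<in>\<sigma>. v (\<Sum>b\<in>D. scaleA (C b) b) x = (INF b\<in>D. v b x))) \<and>
             (\<forall>b\<in>\<B>. \<exists>m\<in>L.dual_lattice. \<forall>x\<in>\<sigma>. v b x = ereal (of_rat (m x)))"
begin

definition val_at :: "nat \<Rightarrow> 'a \<Rightarrow> ereal" where
  "val_at i f = v f (\<rho> i)"

definition filtration :: "nat \<Rightarrow> (nat \<Rightarrow>\<^sub>0 int) \<Rightarrow> 'a set" where
  "filtration j r = {f. \<forall>i\<in>{1..j}. ereal (of_int (Poly_Mapping.lookup r i)) \<le> val_at i f}"

definition rees :: "nat \<Rightarrow> 'a laurent set" where
  "rees j = {p. \<forall>r\<in>Poly_Mapping.keys p. Poly_Mapping.keys r \<subseteq> {1..j} \<and> Poly_Mapping.lookup p r \<in> filtration j r}"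

definition val_ext :: "nat \<Rightarrow> 'a laurent \<Rightarrow> ereal" where
  "val_ext i p = (INF r\<in>Poly_Mapping.keys p. val_at i (Poly_Mapping.lookup p r))"

definition strong_khovanskii_basis :: "'a set \<Rightarrow> bool" where
  "strong_khovanskii_basis \<B> \<longleftrightarrow>
     finite \<B> \<and>
     (\<exists>G. (\<forall>g\<in>G. \<exists>r f. g = Poly_Mapping.single r f) \<and>
          alg_gen (alg_gen A.scalars ((\<lambda>i. tpow i (- 1)) ` {1..n})) G = rees n \<and>
          \<B> = eval_one ` G)"

text \<open>For \<open>b = 0\<close> the exponent below is a dummy value and the product is 0.\<close>

definition next_generators :: "nat \<Rightarrow> 'a laurent set \<Rightarrow> 'a laurent set" where
  "next_generators j B' =
     (\<lambda>b. b * tpow (Suc j) \<lfloor>real_of_ereal (val_ext (Suc j) b)\<rfloor>) ` B' \<union> {tpow (Suc j) (- 1)}"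

text \<open>
  \<open>algorithm step B0 j\<close> is the generating set of \<open>rees j\<close> available after \<open>j\<close> rounds,
  \<open>None\<close> if one of the first \<open>j\<close> rounds does not end.
\<close>

primrec algorithm ::
    "('a laurent set \<Rightarrow> ('a laurent \<Rightarrow> ereal) \<Rightarrow> 'a laurent set \<Rightarrow> 'a laurent set) \<Rightarrow> 'a set \<Rightarrow>
     nat \<Rightarrow> 'a laurent set option" where
  "algorithm step B0 0 = Some (Poly_Mapping.single 0 ` B0)"
| "algorithm step B0 (Suc j) =
     (case algorithm step B0 j of
        None \<Rightarrow> None
      | Some B \<Rightarrow> map_option (next_generators j)
                   (subroutine_result A.scalars step (rees j) (val_ext (Suc j)) B))"

definition algorithm_stops ::
    "('a laurent set \<Rightarrow> ('a laurent \<Rightarrow> ereal) \<Rightarrow> 'a laurent set \<Rightarrow> 'a laurent set) \<Rightarrow> 'a set \<Rightarrow> bool" where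
  "algorithm_stops step B0 \<longleftrightarrow> algorithm step B0 n \<noteq> None"

end

end

theory Submission
  imports Defs
begin

text \<open>
  Write \<open>R j\<close> for the Rees algebra \<open>rees j\<close>, \<open>w\<close> for the extension of the valuation at the ray
  \<open>j + 1\<close> to \<open>R j\<close>, and \<open>t\<close> for the last variable of \<open>R (j + 1)\<close>. Everything rests on two
  specialisations of \<open>R (j + 1)\<close>: setting \<open>t = 1\<close> gives back \<open>R j\<close>, and killing \<open>t\<^sup>-\<^sup>1\<close> gives the
  associated graded algebra of \<open>(R j, w)\<close>.

  Suppose that there is a finite strong Khovanskii basis. Then \<open>R n\<close> is a finitely generated algebra
  over the field (\<open>strong_khovanskii_basis_generators\<close>), with generators that are monomials in the
  variables with coefficients in \<open>A\<close>. Setting the last variables to 1 shows that every \<open>R j\<close> is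
  finitely generated by such monomials (\<open>drop_variables_generators\<close>), and then so is the associated
  graded algebra of every \<open>R j\<close>, being a quotient of \<open>R (j + 1)\<close>
  (\<open>rees_generators_khovanskii_basis\<close>). Hence each round of the algorithm is given a finitely
  generated algebra that has a finite Khovanskii basis, and it ends.

  Suppose conversely that the algorithm stops. By induction on the rounds, the set it holds after
  \<open>j\<close> rounds is finite, consists of homogeneous elements and generates \<open>R j\<close>; for \<open>j = n\<close> this
  gives a strong Khovanskii basis. The induction step is \<open>next_generators_generate\<close>: if the classes
  of a set \<open>B\<close> of homogeneous elements generate the associated graded algebra, then the elements
  \<open>b t\<^sup>w\<^sup>(\<^sup>b\<^sup>)\<close> and \<open>t\<^sup>-\<^sup>1\<close> generate \<open>R (j + 1)\<close>. Indeed a homogeneous \<open>f\<close> agrees, up to an element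
  of higher value and the same degree, with a polynomial in leading terms, and this replacement can be
  repeated. It stops because the values on one graded piece of \<open>A\<close> are bounded: such a piece is
  finite dimensional (\<open>degree_finite_dimensional\<close>), and a basis adapted to the ray leaves
  only finitely many values on a finite dimensional space (\<open>val_at_adapted\<close>).
\<close>

section \<open>Finitely supported functions\<close>

lemma sum_closed:
  assumes "0 \<in> S" "\<And>x y. x \<in> S \<Longrightarrow> y \<in> S \<Longrightarrow> x + y \<in> S" "\<And>x. x \<in> A \<Longrightarrow> f x \<in> S"
  shows "sum f A \<in> S"
  using assms(3) by (induction A rule: infinite_finite_induct) (auto intro: assms)

lemma poly_mapping_sum_single:
  "p = (\<Sum>r\<in>Poly_Mapping.keys p. Poly_Mapping.single r (Poly_Mapping.lookup p r))"
  by (rule poly_mapping_eqI)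
    (simp add: lookup_sum lookup_single when_def in_keys_iff flip: Poly_Mapping.lookup_not_eq_zero_eq_in_keys)

lemma single_sum: "Poly_Mapping.single r (sum f I) = (\<Sum>i\<in>I. Poly_Mapping.single r (f i))"
  by (induction I rule: infinite_finite_induct) (simp_all add: single_add)

lemma mult_sum_single:
  "p * q = (\<Sum>r\<in>Poly_Mapping.keys p. \<Sum>s\<in>Poly_Mapping.keys q.
     Poly_Mapping.single (r + s) (Poly_Mapping.lookup p r * Poly_Mapping.lookup q s))"
proof -
  have "p * q = (\<Sum>r\<in>Poly_Mapping.keys p. Poly_Mapping.single r (Poly_Mapping.lookup p r)) *
                (\<Sum>s\<in>Poly_Mapping.keys q. Poly_Mapping.single s (Poly_Mapping.lookup q s))"
    by (simp flip: poly_mapping_sum_single)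
  then show ?thesis
    by (simp add: sum_product mult_single)
qed

lemma lookup_mult_sum:
  "Poly_Mapping.lookup (p * q) k = (\<Sum>r\<in>Poly_Mapping.keys p. \<Sum>s\<in>Poly_Mapping.keys q.
     (Poly_Mapping.lookup p r * Poly_Mapping.lookup q s when r + s = k))"
  by (subst mult_sum_single) (simp add: lookup_sum lookup_single)

lemma lookup_mult_single_add:
  fixes p :: "'m::cancel_comm_monoid_add \<Rightarrow>\<^sub>0 'a::comm_semiring_1"
  shows "Poly_Mapping.lookup (p * Poly_Mapping.single s 1) (r + s) = Poly_Mapping.lookup p r"
  by (cases "p = 0")
     (auto simp: lookup_mult_sum when_def in_keys_iff)

definition ring_map :: "('r::comm_ring_1 \<Rightarrow> 's::comm_ring_1) \<Rightarrow> bool" where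
  "ring_map \<phi> \<longleftrightarrow> \<phi> 1 = 1 \<and> (\<forall>x y. \<phi> (x + y) = \<phi> x + \<phi> y) \<and> (\<forall>x y. \<phi> (x * y) = \<phi> x * \<phi> y)"

lemma ring_mapD:
  assumes "ring_map \<phi>"
  shows "\<phi> 1 = 1" "\<phi> (x + y) = \<phi> x + \<phi> y" "\<phi> (x * y) = \<phi> x * \<phi> y"
    "\<phi> 0 = 0" "\<phi> (- x) = - \<phi> x" "\<phi> (sum f A) = (\<Sum>a\<in>A. \<phi> (f a))"
proof -
  show "\<phi> 1 = 1" and add: "\<phi> (x + y) = \<phi> x + \<phi> y" and "\<phi> (x * y) = \<phi> x * \<phi> y" for x y
    using assms by (auto simp: ring_map_def)
  show zero: "\<phi> 0 = 0"
    using add[of 0 0] by simp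
  show "\<phi> (- x) = - \<phi> x"
    using add[of x "- x"] zero by (simp add: eq_neg_iff_add_eq_0 add.commute)
  show "\<phi> (sum f A) = (\<Sum>a\<in>A. \<phi> (f a))"
    by (induction A rule: infinite_finite_induct) (simp_all add: zero add)
qed

lemma ring_map_single_zero: "ring_map (Poly_Mapping.single (0::'m::comm_monoid_add))"
  by (simp add: ring_map_def single_add mult_single)

text \<open>The homomorphism out of a monoid algebra given by its universal property. Its instances below set
  variables to 1 and pass between Laurent polynomials in \<open>t\<close> and functions on the exponents of \<open>t\<close>.\<close>

definition subst_hom :: "('a::comm_ring_1 \<Rightarrow> 's::comm_ring_1) \<Rightarrow> ('m \<Rightarrow> 's) \<Rightarrow> ('m \<Rightarrow>\<^sub>0 'a) \<Rightarrow> 's" where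
  "subst_hom \<iota> e p = (\<Sum>r\<in>Poly_Mapping.keys p. \<iota> (Poly_Mapping.lookup p r) * e r)"

lemma subst_hom_single:
  assumes "ring_map \<iota>"
  shows "subst_hom \<iota> e (Poly_Mapping.single r f) = \<iota> f * e r"
  by (simp add: subst_hom_def ring_mapD[OF assms])

lemma ring_map_subst_hom:
  fixes e :: "'m::comm_monoid_add \<Rightarrow> 's::comm_ring_1"
  assumes \<iota>: "ring_map \<iota>" and "e 0 = 1" and e: "\<And>r s. e (r + s) = e r * e s"
  shows "ring_map (subst_hom \<iota> e)"
proof -
  note \<iota>' = ring_mapD[OF \<iota>]
  have add: "subst_hom \<iota> e (x + y) = subst_hom \<iota> e x + subst_hom \<iota> e y" for x y
    unfolding subst_hom_def
    by (rule setsum_keys_plus_distrib) (simp_all add: \<iota>' distrib_right)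
  have sum: "subst_hom \<iota> e (sum g I) = (\<Sum>i\<in>I. subst_hom \<iota> e (g i))" for g and I :: "'i set"
    by (induction I rule: infinite_finite_induct) (simp_all add: add, simp_all add: subst_hom_def)
  have "subst_hom \<iota> e (x * y) = subst_hom \<iota> e x * subst_hom \<iota> e y" for x y
  proof -
    have "subst_hom \<iota> e (x * y) = (\<Sum>r\<in>Poly_Mapping.keys x. \<Sum>s\<in>Poly_Mapping.keys y.
       \<iota> (Poly_Mapping.lookup x r) * e r * (\<iota> (Poly_Mapping.lookup y s) * e s))"
      by (subst mult_sum_single) (simp add: sum subst_hom_single[OF \<iota>] \<iota>' e mult_ac)
    then show ?thesis
      by (simp add: subst_hom_def sum_product)
  qed
  moreover have "subst_hom \<iota> e 1 = 1"
    using assms(2) by (simp add: subst_hom_single[OF \<iota>] \<iota>' flip: single_one)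
  ultimately show ?thesis
    by (simp add: ring_map_def add)
qed

section \<open>Generated subalgebras\<close>

lemma alg_gen_least:
  assumes "K \<subseteq> S" "B \<subseteq> S" "1 \<in> S" "\<And>x. x \<in> S \<Longrightarrow> - x \<in> S"
    "\<And>x y. x \<in> S \<Longrightarrow> y \<in> S \<Longrightarrow> x + y \<in> S" "\<And>x y. x \<in> S \<Longrightarrow> y \<in> S \<Longrightarrow> x * y \<in> S"
  shows "alg_gen K B \<subseteq> S"
proof
  fix x assume "x \<in> alg_gen K B"
  then show "x \<in> S"
    by induction (use assms in auto)
qed

lemma alg_gen_minimal:
  assumes "K \<subseteq> alg_gen K' B'" "B \<subseteq> alg_gen K' B'"
  shows "alg_gen K B \<subseteq> alg_gen K' B'"
  using assms by (intro alg_gen_least) (auto intro: alg_gen.intros)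

lemma alg_gen_mono: "B \<subseteq> B' \<Longrightarrow> alg_gen K B \<subseteq> alg_gen K B'"
  by (intro alg_gen_minimal) (auto intro: alg_gen.intros)

lemma alg_gen_zero: "0 \<in> alg_gen K B"
  using alg_gen.add[OF alg_gen.one alg_gen.minus[OF alg_gen.one], of K B] by simp

lemma alg_gen_sum: "(\<And>x. x \<in> A \<Longrightarrow> f x \<in> alg_gen K B) \<Longrightarrow> sum f A \<in> alg_gen K B"
  by (rule sum_closed) (auto intro: alg_gen_zero alg_gen.add)

lemma alg_gen_power: "x \<in> alg_gen K B \<Longrightarrow> x ^ k \<in> alg_gen K B"
  by (induction k) (auto intro: alg_gen.intros)

lemma alg_gen_prod: "(\<And>x. x \<in> A \<Longrightarrow> f x \<in> alg_gen K B) \<Longrightarrow> prod f A \<in> alg_gen K B"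
  by (induction A rule: infinite_finite_induct) (auto intro: alg_gen.intros)

lemma alg_gen_hom:
  assumes "ring_map \<phi>" "\<phi> ` K \<subseteq> alg_gen K' B'" "\<phi> ` B \<subseteq> alg_gen K' B'" "x \<in> alg_gen K B"
  shows "\<phi> x \<in> alg_gen K' B'"
  using assms(4) by induction (use assms(2,3) in \<open>auto simp: ring_mapD[OF assms(1)] intro: alg_gen.intros\<close>)

text \<open>A product of sums is a sum of products, so an algebra generated by elements of a
  multiplicatively closed set \<open>P\<close> consists of sums of its elements lying in \<open>P\<close>.\<close>

lemma alg_gen_sum_list:
  assumes P: "K \<subseteq> P" "B \<subseteq> P" "1 \<in> P" "\<And>x. x \<in> P \<Longrightarrow> - x \<in> P" "\<And>x y. x \<in> P \<Longrightarrow> y \<in> P \<Longrightarrow> x * y \<in> P"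
    and "x \<in> alg_gen K B"
  shows "\<exists>xs. set xs \<subseteq> alg_gen K B \<inter> P \<and> x = sum_list xs"
proof -
  let ?H = "alg_gen K B \<inter> P"
  let ?L = "{sum_list xs | xs. set xs \<subseteq> ?H}"
  have single: "a \<in> ?L" if "a \<in> ?H" for a
    using that by (auto intro!: exI[of _ "[a]"])
  have add: "a + b \<in> ?L" if "a \<in> ?L" "b \<in> ?L" for a b
  proof -
    from that obtain xs ys where "a = sum_list xs" "b = sum_list ys" "set xs \<subseteq> ?H" "set ys \<subseteq> ?H"
      by blast
    then show ?thesis
      by (auto intro!: exI[of _ "xs @ ys"])
  qed
  have minus: "- a \<in> ?L" if "a \<in> ?L" for a
  proof -
    from that obtain xs where "a = sum_list xs" "set xs \<subseteq> ?H"
      by blast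
    then show ?thesis
      by (auto intro!: exI[of _ "map uminus xs"] alg_gen.minus P simp: uminus_sum_list_map[of id xs, simplified])
  qed
  have mult1: "a * b \<in> ?L" if a: "a \<in> ?H" and "b \<in> ?L" for a b
  proof -
    from that obtain ys where "b = sum_list ys" "set ys \<subseteq> ?H"
      by blast
    with a show ?thesis
      by (auto intro!: exI[of _ "map ((*) a) ys"] alg_gen.mult P simp: sum_list_const_mult)
  qed
  have zero: "0 \<in> ?L"
    by (auto intro!: exI[of _ "[]"])
  have mult: "a * b \<in> ?L" if "a \<in> ?L" and b: "b \<in> ?L" for a b
  proof -
    from that obtain xs where a: "a = sum_list xs" and "set xs \<subseteq> ?H"
      by blast
    from this(2) have "sum_list xs * b \<in> ?L"
    proof (induction xs)
      case Nil
      then show ?case using zero by simp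
    next
      case (Cons y ys)
      then show ?case
        using add[OF mult1[OF _ b, of y]] by (simp add: distrib_right)
    qed
    then show ?thesis by (simp add: a)
  qed
  have "alg_gen K B \<subseteq> ?L"
  proof (rule alg_gen_least)
    show "K \<subseteq> ?L"
      by (rule subsetI, rule single) (use P(1) in \<open>auto intro: alg_gen.scalar\<close>)
    show "B \<subseteq> ?L"
      by (rule subsetI, rule single) (use P(2) in \<open>auto intro: alg_gen.gen\<close>)
    show "1 \<in> ?L"
      by (rule single) (use P(3) in \<open>auto intro: alg_gen.one\<close>)
  qed (fact add minus mult)+
  then show ?thesis
    using assms(6) by blast
qed

section \<open>Khovanskii bases\<close>

text \<open>The representative of \<open>gr_class R w b\<close> in the filtration ring.\<close>

definition leading_term :: "('r::comm_ring_1 \<Rightarrow> ereal) \<Rightarrow> 'r \<Rightarrow> int \<Rightarrow>\<^sub>0 'r" where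
  "leading_term w b = Poly_Mapping.single \<lfloor>real_of_ereal (w b)\<rfloor> b"

text \<open>That \<open>- 1\<close> is a scalar, hence has value 0 or is 0, yields \<open>w (- x) = w x\<close>.\<close>

locale valued_algebra =
  fixes K R :: "'r::comm_ring_1 set" and w :: "'r \<Rightarrow> ereal"
  assumes R_minus: "x \<in> R \<Longrightarrow> - x \<in> R"
    and R_add: "x \<in> R \<Longrightarrow> y \<in> R \<Longrightarrow> x + y \<in> R"
    and R_mult: "x \<in> R \<Longrightarrow> y \<in> R \<Longrightarrow> x * y \<in> R"
    and K_subset: "K \<subseteq> R"
    and one_K: "1 \<in> K"
    and minus_one_K: "- 1 \<in> K"
    and valuation: "int_valuation K R w"
begin

lemma R_one: "1 \<in> R"
  using K_subset one_K by auto

lemma R_zero: "0 \<in> R"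
  using R_add[OF R_one R_minus[OF R_one]] by simp

lemma w_mult: "x \<in> R \<Longrightarrow> y \<in> R \<Longrightarrow> w (x * y) = w x + w y"
  and w_add: "x \<in> R \<Longrightarrow> y \<in> R \<Longrightarrow> min (w x) (w y) \<le> w (x + y)"
  and w_zero: "w 0 = \<infinity>"
  and w_scalar: "c \<in> K \<Longrightarrow> c \<noteq> 0 \<Longrightarrow> w c = 0"
  and w_int: "x \<in> R \<Longrightarrow> w x = \<infinity> \<or> (\<exists>z::int. w x = ereal (of_int z))"
  using valuation by (auto simp: int_valuation_def)

lemma w_one: "0 \<le> w 1"
  using w_scalar[OF one_K] w_zero by (cases "(1::'r) = 0") auto

lemma w_minus: "x \<in> R \<Longrightarrow> w (- x) = w x"
proof (cases "(1::'r) = 0")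
  case True
  then have "y = 0" for y :: 'r
    by (metis mult_1 mult_zero_left)
  then show ?thesis by metis
next
  case False
  assume "x \<in> R"
  then show ?thesis
    using w_mult[of "- 1" x] w_scalar[OF minus_one_K] K_subset minus_one_K False by auto
qed

abbreviation "FR \<equiv> filtration_ring R w"
abbreviation "FI \<equiv> filtration_ideal R w"

definition level :: "int \<Rightarrow> 'r set" where "level c = {x \<in> R. ereal (of_int c) \<le> w x}"
definition above :: "int \<Rightarrow> 'r set" where "above c = {x \<in> R. ereal (of_int c) < w x}"

lemma carrier_FR: "carrier FR = {g. \<forall>c. Poly_Mapping.lookup g c \<in> level c}"
  by (simp add: filtration_ring_def level_def)

lemma FI_eq: "FI = {g. \<forall>c. Poly_Mapping.lookup g c \<in> above c}"
  by (simp add: filtration_ideal_def above_def)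

lemma level_zero: "0 \<in> level c" and above_zero: "0 \<in> above c"
  by (simp_all add: level_def above_def R_zero w_zero)

lemma level_add: "x \<in> level c \<Longrightarrow> y \<in> level c \<Longrightarrow> x + y \<in> level c"
  and above_add: "x \<in> above c \<Longrightarrow> y \<in> above c \<Longrightarrow> x + y \<in> above c"
  using w_add[of x y] by (auto simp: level_def above_def R_add min_def split: if_splits)

lemma level_minus: "x \<in> level c \<Longrightarrow> - x \<in> level c"
  and above_minus: "x \<in> above c \<Longrightarrow> - x \<in> above c"
  by (auto simp: level_def above_def R_minus w_minus)

lemma level_mult: "x \<in> level c \<Longrightarrow> y \<in> level d \<Longrightarrow> x * y \<in> level (c + d)"
  using w_mult[of x y] add_mono[of "ereal (of_int c)" "w x" "ereal (of_int d)" "w y"]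
  by (auto simp: level_def R_mult)

text \<open>Adding a finite value preserves strict inequality; if the
  value of \<open>x\<close> is infinite, so is that of the product.\<close>

lemma above_mult: "x \<in> level c \<Longrightarrow> y \<in> above d \<Longrightarrow> x * y \<in> above (c + d)"
  using w_mult[of x y] w_int[of x] w_int[of y]
  by (auto simp: level_def above_def R_mult simp del: of_int_add simp flip: of_int_add)

lemma above_subset: "above c \<subseteq> level c"
  by (auto simp: level_def above_def)

lemma FI_subset: "FI \<subseteq> carrier FR"
  using above_subset by (auto simp: carrier_FR FI_eq)

lemma FR_ops [simp]:
  "mult FR = (*)" "one FR = 1" "add FR = (+)" "zero FR = 0"
  by (simp_all add: filtration_ring_def)

lemma FR_one: "1 \<in> carrier FR"
  using w_one by (auto simp: carrier_FR lookup_one when_def level_zero) (simp add: level_def R_one zero_ereal_def)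

lemma FR_zero: "0 \<in> carrier FR" and FI_zero: "0 \<in> FI"
  by (simp_all add: carrier_FR FI_eq level_zero above_zero)

lemma FR_add: "x \<in> carrier FR \<Longrightarrow> y \<in> carrier FR \<Longrightarrow> x + y \<in> carrier FR"
  and FI_add: "x \<in> FI \<Longrightarrow> y \<in> FI \<Longrightarrow> x + y \<in> FI"
  by (simp_all add: carrier_FR FI_eq lookup_add level_add above_add)

lemma FR_minus: "x \<in> carrier FR \<Longrightarrow> - x \<in> carrier FR"
  and FI_minus: "x \<in> FI \<Longrightarrow> - x \<in> FI"
  by (simp_all add: carrier_FR FI_eq level_minus above_minus)

lemma FR_mult: "x \<in> carrier FR \<Longrightarrow> y \<in> carrier FR \<Longrightarrow> x * y \<in> carrier FR"
  by (auto simp: carrier_FR lookup_mult_sum when_def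
      intro!: sum_closed[of "level _"] level_add level_zero level_mult)

lemma FI_mult: "x \<in> carrier FR \<Longrightarrow> y \<in> FI \<Longrightarrow> x * y \<in> FI"
  by (auto simp: carrier_FR FI_eq lookup_mult_sum when_def
      intro!: sum_closed[of "above _"] above_add above_zero above_mult)

lemma cring_FR: "cring FR"
proof (rule cringI)
  show "abelian_group FR"
    by (rule abelian_groupI) (auto simp: FR_add FR_zero add_ac intro: FR_minus exI[of _ "- _"] bexI[of _ "- _"])
  show "comm_monoid FR"
    by (rule comm_monoidI) (auto simp: FR_mult FR_one mult_ac)
qed (simp add: distrib_right)

lemma ideal_FI: "ideal FI FR"
proof (rule idealI)
  show "ring FR"
    using cring_FR by (rule cring.axioms)
  show "subgroup FI (add_monoid FR)"
  proof
    show "FI \<subseteq> carrier (add_monoid FR)"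
      using FI_subset by simp
    fix x assume x: "x \<in> FI"
    then have "inv\<^bsub>add_monoid FR\<^esub> x = - x"
      using FI_subset FR_minus ring.is_abelian_group[OF cring.axioms(1)[OF cring_FR]]
      by (intro group.inv_equality[OF abelian_group.a_group]) auto
    then show "inv\<^bsub>add_monoid FR\<^esub> x \<in> FI"
      using x by (simp add: FI_minus)
  qed (auto simp: FI_add FI_zero)
  show "x \<otimes>\<^bsub>FR\<^esub> a \<in> FI" "a \<otimes>\<^bsub>FR\<^esub> x \<in> FI" if "a \<in> FI" "x \<in> carrier FR" for a x
    using FI_mult[OF that(2,1)] by (simp_all add: mult.commute[of a x])
qed

lemma leading_term_FR: "b \<in> R \<Longrightarrow> leading_term w b \<in> carrier FR"
  using w_int[of b]
  by (auto simp: carrier_FR leading_term_def lookup_single when_def level_zero) (auto simp: level_def)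

lemma leading_terms_FR:
  assumes "B \<subseteq> R" shows "alg_gen (leading_term w ` K) (leading_term w ` B) \<subseteq> carrier FR"
  by (rule alg_gen_least)
    (use assms K_subset in \<open>auto simp: FR_one FR_minus FR_add FR_mult intro: leading_term_FR\<close>)

text \<open>The quotient map turns the algebra generated by the leading terms into the subring generated by
  the classes; so the classes generate the associated graded algebra iff every element of the
  filtration ring agrees, up to terms of higher value, with a polynomial in leading terms.\<close>

lemma khovanskii_basis_iff:
  assumes B: "B \<subseteq> R"
  shows "khovanskii_basis K R w B \<longleftrightarrow>
    (\<forall>h\<in>carrier FR. \<exists>h'\<in>alg_gen (leading_term w ` K) (leading_term w ` B). h - h' \<in> FI)"
proof -
  interpret I: ideal FI FR by (rule ideal_FI)
  interpret Q: ring "FR Quot FI" by (rule I.quotient_is_ring)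
  define \<pi> where "\<pi> = (\<lambda>x. FI +>\<^bsub>FR\<^esub> x)"
  let ?G = "alg_gen (leading_term w ` K) (leading_term w ` B)"
  let ?C = "gr_class R w ` K \<union> gr_class R w ` B"
  have hom: "ring_hom_ring FR (FR Quot FI) \<pi>"
    unfolding \<pi>_def by (rule I.rcos_ring_hom_ring)
  then interpret \<pi>: ring_hom_ring FR "FR Quot FI" \<pi> .
  have inv: "\<ominus>\<^bsub>FR\<^esub> x = - x" if "x \<in> carrier FR" for x
    using that I.minus_equality[of "- x" x] by (simp add: FR_minus)
  have cls: "gr_class R w b = \<pi> (leading_term w b)" for b
    by (simp add: gr_class_def \<pi>_def leading_term_def)
  have GF: "?G \<subseteq> carrier FR"
    by (rule leading_terms_FR[OF B])
  have "generate_ring (FR Quot FI) ?C = \<pi> ` ?G"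
  proof (intro equalityI subsetI)
    fix X assume "X \<in> generate_ring (FR Quot FI) ?C"
    then show "X \<in> \<pi> ` ?G"
    proof induction
      case one
      then show ?case
        using \<pi>.hom_one by (auto intro!: image_eqI[of _ _ 1] alg_gen.one)
    next
      case (incl X)
      then show ?case
        by (auto simp: cls intro!: imageI intro: alg_gen.intros)
    next
      case (a_inv X)
      then obtain x where "x \<in> ?G" "X = \<pi> x" by blast
      then show ?case
        using \<pi>.hom_a_inv[of x] GF inv[of x] by (auto intro!: image_eqI[of _ _ "- x"] alg_gen.minus)
    next
      case (eng_add X Y)
      then obtain x y where "x \<in> ?G" "X = \<pi> x" "y \<in> ?G" "Y = \<pi> y" by blast
      then show ?case
        using \<pi>.hom_add[of x y] GF by (auto intro!: image_eqI[of _ _ "x + y"] alg_gen.add)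
    next
      case (eng_mult X Y)
      then obtain x y where "x \<in> ?G" "X = \<pi> x" "y \<in> ?G" "Y = \<pi> y" by blast
      then show ?case
        using \<pi>.hom_mult[of x y] GF by (auto intro!: image_eqI[of _ _ "x * y"] alg_gen.mult)
    qed
  next
    fix X assume "X \<in> \<pi> ` ?G"
    then obtain x where x: "x \<in> ?G" and X: "X = \<pi> x" by blast
    from x have "\<pi> x \<in> generate_ring (FR Quot FI) ?C"
    proof induction
      case one
      then show ?case
        using \<pi>.hom_one generate_ring.one[of "FR Quot FI" ?C] by simp
    next
      case (scalar c)
      then show ?case
        by (auto simp flip: cls intro!: generate_ring.incl)
    next
      case (gen b)
      then show ?case
        by (auto simp flip: cls intro!: generate_ring.incl)
    next
      case (minus x)
      then show ?case
        using \<pi>.hom_a_inv[of x] GF inv[of x] generate_ring.a_inv by fastforce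
    next
      case (add x y)
      then show ?case
        using \<pi>.hom_add[of x y] GF generate_ring.eng_add[of "\<pi> x" "FR Quot FI" ?C "\<pi> y"]
        by (simp add: subset_iff)
    next
      case (mult x y)
      then show ?case
        using \<pi>.hom_mult[of x y] GF generate_ring.eng_mult[of "\<pi> x" "FR Quot FI" ?C "\<pi> y"]
        by (simp add: subset_iff)
    qed
    then show "X \<in> generate_ring (FR Quot FI) ?C"
      by (simp add: X)
  qed
  moreover have "carrier (FR Quot FI) = \<pi> ` carrier FR"
    by (auto simp: FactRing_def A_RCOSETS_def' \<pi>_def)
  moreover have "\<pi> x = \<pi> y \<longleftrightarrow> x - y \<in> FI" if "x \<in> carrier FR" "y \<in> carrier FR" for x y
    using I.quotient_eq_iff_same_a_r_cos[OF ideal_FI that] that inv[of y]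
    by (simp add: \<pi>_def a_minus_def)
  ultimately show ?thesis
    using GF B unfolding khovanskii_basis_def gr_def by (auto simp: image_iff subset_iff set_eq_iff) metis+
qed

end

section \<open>Homogeneous components\<close>

context graded_domain
begin

definition components :: "'a \<Rightarrow> nat \<Rightarrow>\<^sub>0 'a" where
  "components f = (THE g. (\<forall>m. Poly_Mapping.lookup g m \<in> Agr m) \<and>
     f = (\<Sum>m\<in>Poly_Mapping.keys g. Poly_Mapping.lookup g m))"

definition component :: "nat \<Rightarrow> 'a \<Rightarrow> 'a" where
  "component m f = Poly_Mapping.lookup (components f) m"

lemma component_in: "component m f \<in> Agr m"
  and sum_components: "f = (\<Sum>m\<in>Poly_Mapping.keys (components f). component m f)"
  using theI'[OF graded_sum[of f], folded components_def] by (auto simp: component_def)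

lemma components_eqI:
  assumes "\<And>m. Poly_Mapping.lookup g m \<in> Agr m" "f = (\<Sum>m\<in>Poly_Mapping.keys g. Poly_Mapping.lookup g m)"
  shows "components f = g"
  unfolding components_def by (rule the1_equality[OF graded_sum]) (use assms in auto)

lemma component_add: "component m (f + g) = component m f + component m g"
proof -
  have "components (f + g) = components f + components g"
  proof (rule components_eqI)
    show "Poly_Mapping.lookup (components f + components g) m \<in> Agr m" for m
      using component_in[of m f] component_in[of m g] subspace_add[OF graded_subspace]
      by (simp add: lookup_add component_def)
    have "(\<Sum>m\<in>Poly_Mapping.keys (components f + components g). Poly_Mapping.lookup (components f + components g) m) =
      (\<Sum>m\<in>Poly_Mapping.keys (components f). Poly_Mapping.lookup (components f) m) +
      (\<Sum>m\<in>Poly_Mapping.keys (components g). Poly_Mapping.lookup (components g) m)"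
      by (rule setsum_keys_plus_distrib) simp_all
    then show "f + g = (\<Sum>m\<in>Poly_Mapping.keys (components f + components g). Poly_Mapping.lookup (components f + components g) m)"
      using sum_components[of f] sum_components[of g] by (simp add: component_def)
  qed
  then show ?thesis
    by (simp add: component_def lookup_add)
qed

lemma component_homogeneous:
  assumes "f \<in> Agr l" shows "component m f = (if m = l then f else 0)"
proof -
  have "components f = Poly_Mapping.single l f"
    by (rule components_eqI) (use assms subspace_0[OF graded_subspace] in \<open>auto simp: lookup_single when_def\<close>)
  then show ?thesis
    by (auto simp: component_def lookup_single)
qed

lemma component_zero: "component m 0 = 0"
  using component_homogeneous[OF subspace_0[OF graded_subspace], of m m] by simp

lemma component_sum: "component m (sum f I) = (\<Sum>i\<in>I. component m (f i))"
  by (induction I rule: infinite_finite_induct) (simp_all add: component_add component_zero)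

lemma component_diff: "component m (f - g) = component m f - component m g"
  using component_add[of m "f - g" g] by simp

lemma component_mult:
  assumes b: "b \<in> Agr d"
  shows "component m (b * y) = (if d \<le> m then b * component (m - d) y else 0)"
proof -
  have "b * y = (\<Sum>l\<in>Poly_Mapping.keys (components y). b * component l y)"
    by (subst sum_components[of y]) (simp add: sum_distrib_left)
  then have "component m (b * y) = (\<Sum>l\<in>Poly_Mapping.keys (components y). component m (b * component l y))"
    by (simp add: component_sum)
  also have "\<dots> = (\<Sum>l\<in>Poly_Mapping.keys (components y). if m = d + l then b * component l y else 0)"
    by (intro sum.cong) (auto simp: component_homogeneous[OF graded_mult[OF b component_in]])
  also have "\<dots> = (\<Sum>l\<in>Poly_Mapping.keys (components y). if l = m - d then (if d \<le> m then b * component l y else 0) else 0)"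
    by (intro sum.cong) auto
  also have "\<dots> = (if d \<le> m then b * component (m - d) y else 0)"
    by (simp add: sum.delta in_keys_iff component_def)
  finally show ?thesis .
qed

lemma scale_scalar: "scaleA c x = scaleA c 1 * x"
  using scale_mult[of c 1 x] by simp

lemma one_in_degree_zero: "1 \<in> Agr 0"
  using graded_zero by (metis rangeI scale_one)

text \<open>A polynomial in homogeneous generators is a scalar plus an element of the ideal generated by
  the generators of positive degree. In degree \<open>m\<close> this expresses \<open>Agr m\<close> through graded
  pieces of smaller degree.\<close>

lemma degree_finite_dimensional:
  assumes "finite B0" "alg_gen (range (\<lambda>c. scaleA c 1)) B0 = UNIV" "\<forall>b\<in>B0. \<exists>m. b \<in> Agr m"
  shows "\<exists>S. finite S \<and> Agr m \<subseteq> span S"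
proof -
  define P where "P = {b\<in>B0. b \<notin> Agr 0}"
  have "finite P"
    using assms(1) by (simp add: P_def)
  obtain deg where deg: "b \<in> Agr (deg b)" if "b \<in> P" for b
    using assms(3) unfolding P_def by (metis mem_Collect_eq)
  have deg_pos: "deg b > 0" if "b \<in> P" for b
    using that deg[OF that] by (cases "deg b") (auto simp: P_def)
  let ?S = "{x. \<exists>c a. x = scaleA c 1 + (\<Sum>b\<in>P. b * a b)}"
  have S: "x \<in> ?S" if "x = scaleA c 1 + (\<Sum>b\<in>P. b * a b)" for x c a
    using that by blast
  have scalar: "scaleA c 1 \<in> ?S" for c
    by (auto intro!: exI[of _ c] exI[of _ "\<lambda>_. 0"])
  have "alg_gen (range (\<lambda>c. scaleA c 1)) B0 \<subseteq> ?S"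
  proof (rule alg_gen_least)
    show "range (\<lambda>c. scaleA c 1) \<subseteq> ?S"
      using scalar by blast
    show "1 \<in> ?S"
      using scalar[of 1] by simp
    show "B0 \<subseteq> ?S"
    proof
      fix b assume b: "b \<in> B0"
      show "b \<in> ?S"
      proof (cases "b \<in> P")
        case True
        then have "b = scaleA 0 1 + (\<Sum>b'\<in>P. b' * (if b' = b then 1 else 0))"
          using \<open>finite P\<close> by (simp add: sum.delta if_distrib cong: if_cong)
        then show ?thesis
          by (rule S)
      next
        case False
        then have "b \<in> range (\<lambda>c. scaleA c 1)"
          using b graded_zero by (auto simp: P_def)
        then show ?thesis
          using scalar by blast
      qed
    qed
  next
    fix x assume "x \<in> ?S"
    then obtain c a where "x = scaleA c 1 + (\<Sum>b\<in>P. b * a b)" by blast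
    then have "- x = scaleA (- c) 1 + (\<Sum>b\<in>P. b * (- a b))"
      by (simp add: sum_negf)
    then show "- x \<in> ?S" by (rule S)
  next
    fix x y assume "x \<in> ?S" "y \<in> ?S"
    then obtain c a d a' where x: "x = scaleA c 1 + (\<Sum>b\<in>P. b * a b)"
      and y: "y = scaleA d 1 + (\<Sum>b\<in>P. b * a' b)" by blast
    have "x + y = scaleA (c + d) 1 + (\<Sum>b\<in>P. b * (a b + a' b))"
      by (simp add: x y scale_left_distrib distrib_left sum.distrib)
    then show "x + y \<in> ?S" by (rule S)
    have "x * y = scaleA c 1 * scaleA d 1 + (\<Sum>b\<in>P. b * a' b) * scaleA c 1 + (\<Sum>b\<in>P. b * a b) * y"
      by (simp add: x y algebra_simps)
    also have "scaleA c 1 * scaleA d 1 = scaleA (c * d) 1"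
      using scale_scalar[of c "scaleA d 1"] by simp
    finally have "x * y = scaleA (c * d) 1 + (\<Sum>b\<in>P. b * (a' b * scaleA c 1 + a b * y))"
      by (simp add: sum_distrib_right distrib_left sum.distrib mult.assoc)
    then show "x * y \<in> ?S" by (rule S)
  qed
  then have decomp: "\<exists>c a. x = scaleA c 1 + (\<Sum>b\<in>P. b * a b)" for x
    using assms(2) by auto
  show ?thesis
  proof (induction m rule: less_induct)
    case (less m)
    show ?case
    proof (cases "m = 0")
      case True
      have "Agr 0 \<subseteq> span {1}"
        using graded_zero by (auto intro: span_scale span_base)
      with True show ?thesis by blast
    next
      case False
      have "\<forall>l. \<exists>S. l < m \<longrightarrow> finite S \<and> Agr l \<subseteq> span S"
        using less.IH by blast
      then obtain T where T: "finite (T l)" "Agr l \<subseteq> span (T l)" if "l < m" for l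
        by metis
      let ?U = "\<Union>b\<in>{b\<in>P. deg b \<le> m}. (*) b ` T (m - deg b)"
      have lt: "m - deg b < m" if "b \<in> P" for b
        using deg_pos[OF that] False by simp
      have "Agr m \<subseteq> span ?U"
      proof
        fix x assume "x \<in> Agr m"
        obtain c a where x: "x = scaleA c 1 + (\<Sum>b\<in>P. b * a b)"
          using decomp by blast
        have "x = component m x"
          using component_homogeneous[OF \<open>x \<in> Agr m\<close>] by simp
        also have "\<dots> = component m (scaleA c 1) + (\<Sum>b\<in>P. component m (b * a b))"
          by (simp add: x component_add component_sum)
        also have "component m (scaleA c 1) = 0"
          using component_homogeneous[of "scaleA c 1" 0 m] False graded_zero by auto
        also have "(\<Sum>b\<in>P. component m (b * a b)) =
            (\<Sum>b\<in>P. if deg b \<le> m then b * component (m - deg b) (a b) else 0)"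
          by (intro sum.cong refl component_mult deg)
        finally have "x = (\<Sum>b\<in>P. if deg b \<le> m then b * component (m - deg b) (a b) else 0)"
          by simp
        also have "\<dots> \<in> span ?U"
        proof (rule span_sum)
          fix b assume b: "b \<in> P"
          have "b * y \<in> span ?U" if "deg b \<le> m" and "y \<in> span (T (m - deg b))" for y
            using that(2)
          proof (induction rule: span_induct_alt)
            case base
            then show ?case by (simp add: span_zero)
          next
            case (step c y z)
            have "b * (scaleA c y + z) = scaleA c (b * y) + b * z"
              using scale_scalar[of c y] scale_scalar[of c "b * y"] by (simp add: algebra_simps)
            moreover have "b * y \<in> span ?U"
              using step(1) b that(1) by (intro span_base) auto
            ultimately show ?case
              using step(2) by (simp add: span_add span_scale)
          qed
          then show "(if deg b \<le> m then b * component (m - deg b) (a b) else 0) \<in> span ?U"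
            using T(2)[OF lt[OF b]] component_in[of "m - deg b" "a b"] span_zero by auto
        qed
        finally show "x \<in> span ?U" .
      qed
      moreover have "finite ?U"
        using \<open>finite P\<close> T(1) lt by auto
      ultimately show ?thesis by blast
    qed
  qed
qed

lemma single_scalar: "Poly_Mapping.single 0 (scaleA c 1) \<in> scalars"
  by (simp add: scalars_def)

lemma scalars_eq: "scalars = Poly_Mapping.single 0 ` range (\<lambda>c. scaleA c 1)"
  by (auto simp: scalars_def)

lemma one_scalar: "1 \<in> scalars" and minus_one_scalar: "- 1 \<in> scalars"
  using single_scalar[of 1] single_scalar[of "- 1"] by (simp_all add: single_uminus)

lemma homogeneous_scalar: "x \<in> scalars \<Longrightarrow> homogeneous x"
  unfolding scalars_def homogeneous_def using graded_zero by blast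

lemma homogeneous_minus: "homogeneous x \<Longrightarrow> homogeneous (- x)"
  unfolding homogeneous_def using subspace_neg[OF graded_subspace] by (metis single_uminus)

lemma homogeneous_mult: "homogeneous x \<Longrightarrow> homogeneous y \<Longrightarrow> homogeneous (x * y)"
  unfolding homogeneous_def using graded_mult by (fastforce simp: mult_single)

definition laurent_component :: "nat \<Rightarrow> (nat \<Rightarrow>\<^sub>0 int) \<Rightarrow> 'a laurent \<Rightarrow> 'a laurent" where
  "laurent_component m r p = Poly_Mapping.single r (component m (Poly_Mapping.lookup p r))"

lemma laurent_component_homogeneous:
  "homogeneous p \<Longrightarrow> laurent_component m r p = p \<or> laurent_component m r p = 0"
  by (auto simp: homogeneous_def laurent_component_def lookup_single when_def component_zero
      component_homogeneous)

text \<open>Products of scalars and homogeneous generators are homogeneous and span the generated algebra, so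
  it is a graded subspace of the Laurent polynomial ring.\<close>

lemma laurent_component_alg_gen:
  assumes "\<forall>b\<in>B. homogeneous b" "x \<in> alg_gen scalars B"
  shows "laurent_component m r x \<in> alg_gen scalars B"
proof -
  obtain xs where xs: "set xs \<subseteq> alg_gen scalars B \<inter> Collect homogeneous" and x: "x = sum_list xs"
    using alg_gen_sum_list[of scalars "Collect homogeneous" B x] assms homogeneous_scalar one_scalar
    by (auto simp: homogeneous_minus homogeneous_mult)
  from xs have "laurent_component m r (sum_list xs) \<in> alg_gen scalars B"
  proof (induction xs)
    case Nil
    then show ?case
      by (simp add: laurent_component_def component_zero alg_gen_zero)
  next
    case (Cons y ys)
    have "laurent_component m r y \<in> alg_gen scalars B"
      using Cons.prems laurent_component_homogeneous[of y m r] alg_gen_zero by auto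
    moreover have "laurent_component m r (y + z) = laurent_component m r y + laurent_component m r z" for z
      by (simp add: laurent_component_def lookup_add component_add single_add)
    ultimately show ?case
      using Cons by (auto intro: alg_gen.add)
  qed
  then show ?thesis by (simp add: x)
qed

end

section \<open>The valuations at the rays\<close>

context toric_flat_valuation
begin

lemma ray_cone:
  assumes "i \<in> {1..n}"
  obtains \<sigma> where "\<sigma> \<in> \<Sigma>" "\<rho> i \<in> \<sigma>"
proof
  show "L.cone_over {\<rho> i} \<in> \<Sigma>"
    using bij_betwE[OF ray_gens] assms by (auto simp: L.rays_def)
  show "\<rho> i \<in> L.cone_over {\<rho> i}"
    by (auto simp: L.cone_over_def intro!: exI[of _ "\<lambda>_. 1"])
qed

lemma ray_in_support: "i \<in> {1..n} \<Longrightarrow> \<rho> i \<in> \<Union>\<Sigma>"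
  by (metis UnionI ray_cone)

lemma val_at_zero: "i \<in> {1..n} \<Longrightarrow> val_at i 0 = \<infinity>"
  and val_at_mult: "i \<in> {1..n} \<Longrightarrow> val_at i (f * g) = val_at i f + val_at i g"
  and val_at_add: "i \<in> {1..n} \<Longrightarrow> min (val_at i f) (val_at i g) \<le> val_at i (f + g)"
  and val_at_sum: "i \<in> {1..n} \<Longrightarrow> finite D \<Longrightarrow> (\<And>m. m \<in> D \<Longrightarrow> h m \<in> Agr m) \<Longrightarrow>
    val_at i (\<Sum>m\<in>D. h m) = (INF m\<in>D. val_at i (h m))"
  by (simp_all only: val_at_def val_zero[OF ray_in_support] val_mult[OF ray_in_support]
      val_add[OF ray_in_support] val_homogeneous[OF _ _ ray_in_support])

lemma val_at_scalar: "i \<in> {1..n} \<Longrightarrow> c \<noteq> 0 \<Longrightarrow> val_at i (scaleA c 1) = 0"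
  unfolding val_at_def by (rule val_scalar[OF _ ray_in_support])

lemma val_at_add_ge: "i \<in> {1..n} \<Longrightarrow> c \<le> val_at i f \<Longrightarrow> c \<le> val_at i g \<Longrightarrow> c \<le> val_at i (f + g)"
  by (rule order_trans[OF _ val_at_add]) simp_all

lemma val_at_add_gt: "i \<in> {1..n} \<Longrightarrow> c < val_at i f \<Longrightarrow> c < val_at i g \<Longrightarrow> c < val_at i (f + g)"
  by (rule less_le_trans[OF _ val_at_add]) simp_all

lemma val_at_one: "i \<in> {1..n} \<Longrightarrow> val_at i 1 = 0"
  using val_at_scalar[of i 1] by simp

lemma val_at_minus: "i \<in> {1..n} \<Longrightarrow> val_at i (- f) = val_at i f"
  using val_at_mult[of i "- 1" f] val_at_scalar[of i "- 1"] by simp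

text \<open>The value of an element is the minimum of the values of its homogeneous components.\<close>

lemma val_at_component_ge:
  assumes "i \<in> {1..n}" shows "val_at i f \<le> val_at i (A.component m f)"
proof (cases "m \<in> Poly_Mapping.keys (A.components f)")
  case True
  have "val_at i f = (INF m\<in>Poly_Mapping.keys (A.components f). val_at i (A.component m f))"
    using val_at_sum[OF assms finite_keys, of "A.components f" "\<lambda>m. A.component m f"]
    by (simp add: A.component_in flip: A.sum_components)
  then show ?thesis
    using INF_lower[OF True, of "\<lambda>m. val_at i (A.component m f)"] by simp
next
  case False
  then show ?thesis
    using assms by (simp add: A.component_def in_keys_iff val_at_zero)
qed

text \<open>The elements of a finite dimensional space involve only finitely many members of a basis adapted to
  a cone containing the ray, and a nonzero element has the value of one of these members. That value is
  an integer because an element of the dual lattice is evaluated at a lattice point.\<close>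

lemma val_at_adapted:
  assumes i: "i \<in> {1..n}" and "finite S"
  shows "\<exists>T. finite T \<and> (\<forall>b\<in>T. \<exists>z::int. val_at i b = ereal (of_int z)) \<and>
    (\<forall>f\<in>A.span S. f \<noteq> 0 \<longrightarrow> (\<exists>b\<in>T. val_at i f = val_at i b))"
proof -
  obtain \<sigma> where \<sigma>: "\<sigma> \<in> \<Sigma>" "\<rho> i \<in> \<sigma>"
    using ray_cone[OF i] .
  obtain \<B> where \<B>: "A.independent \<B>" "A.span \<B> = UNIV"
    and adapted: "\<forall>D C. finite D \<and> D \<subseteq> \<B> \<and> (\<forall>b\<in>D. C b \<noteq> 0) \<longrightarrow>
                    (\<forall>x\<in>\<sigma>. v (\<Sum>b\<in>D. scaleA (C b) b) x = (INF b\<in>D. v b x))"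
    and linear: "\<forall>b\<in>\<B>. \<exists>m\<in>L.dual_lattice. \<forall>x\<in>\<sigma>. v b x = ereal (of_rat (m x))"
    using adapted_bases[OF \<sigma>(1)] by (elim exE conjE)
  have sum: "v (\<Sum>b\<in>D. scaleA (C b) b) (\<rho> i) = (INF b\<in>D. v b (\<rho> i))"
    if "finite D" "D \<subseteq> \<B>" "\<forall>b\<in>D. C b \<noteq> 0" for D C
    using adapted[rule_format, of D C "\<rho> i"] that \<sigma>(2) by simp
  have lin: "\<exists>m\<in>L.dual_lattice. v b (\<rho> i) = ereal (of_rat (m (\<rho> i)))" if "b \<in> \<B>" for b
    using linear that \<sigma>(2) by blast
  have "\<exists>T. finite T \<and> T \<subseteq> \<B> \<and> s \<in> A.span T" for s
  proof -
    have "s \<in> A.span \<B>" using \<B>(2) by simp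
    then obtain T r where "finite T" "T \<subseteq> \<B>" "s = (\<Sum>a\<in>T. scaleA (r a) a)"
      by (auto simp: A.span_explicit)
    then show ?thesis
      by (intro exI[of _ T]) (simp add: A.span_sum A.span_scale A.span_base)
  qed
  then obtain t where t: "finite (t s)" "t s \<subseteq> \<B>" "s \<in> A.span (t s)" for s
    by metis
  define T where "T = (\<Union>s\<in>S. t s)"
  have T: "finite T" "T \<subseteq> \<B>"
    unfolding T_def using finite_UN_I[OF \<open>finite S\<close> t(1)] UN_least[of S t, OF t(2)] .
  have "s \<in> A.span T" if "s \<in> S" for s
    using t(3)[of s] A.span_mono[OF UN_upper[OF that], of t] unfolding T_def by (rule rev_subsetD)
  then have "S \<subseteq> A.span T"
    by (rule subsetI)
  then have span: "A.span S \<subseteq> A.span T"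
    by (rule A.span_minimal[OF _ A.subspace_span])
  show ?thesis
  proof (intro exI[of _ T] conjI ballI impI)
    show "finite T" by (rule T)
  next
    fix b assume "b \<in> T"
    then obtain m where m: "m \<in> L.dual_lattice" "v b (\<rho> i) = ereal (of_rat (m (\<rho> i)))"
      using lin T by blast
    have "m (\<rho> i) \<in> \<int>"
      using m(1) primitive_gens[OF i] by (auto simp: L.dual_lattice_def L.primitive_def)
    then show "\<exists>z::int. val_at i b = ereal (of_int z)"
      using m(2) by (auto simp: val_at_def elim!: Ints_cases)
  next
    fix f assume f: "f \<in> A.span S" "f \<noteq> 0"
    then obtain C where C: "f = (\<Sum>b\<in>T. scaleA (C b) b)"
      using span A.span_finite[OF T(1)] by auto
    define D where "D = {b\<in>T. C b \<noteq> 0}"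
    have "f = (\<Sum>b\<in>D. scaleA (C b) b)"
      unfolding C D_def by (rule sum.mono_neutral_right) (use T in auto)
    moreover have "finite D" "D \<subseteq> \<B>" "\<forall>b\<in>D. C b \<noteq> 0"
      using T by (auto simp: D_def)
    ultimately have v: "val_at i f = (INF b\<in>D. val_at i b)"
      using sum by (simp add: val_at_def)
    have "D \<noteq> {}"
      using f(2) \<open>f = (\<Sum>b\<in>D. scaleA (C b) b)\<close> by auto
    then have "(INF b\<in>D. val_at i b) \<in> val_at i ` D"
      using \<open>finite D\<close> by (simp add: Min_Inf[symmetric] del: Min_Inf)
    then show "\<exists>b\<in>T. val_at i f = val_at i b"
      using v by (auto simp: D_def)
  qed
qed

lemma val_at_int:
  assumes i: "i \<in> {1..n}" and "f \<noteq> 0" shows "\<exists>z::int. val_at i f = ereal (of_int z)"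
proof -
  have "finite {f}" by simp
  from val_at_adapted[OF i this] obtain T
    where T: "\<forall>b\<in>T. \<exists>z::int. val_at i b = ereal (of_int z)"
      "\<forall>g\<in>A.span {f}. g \<noteq> 0 \<longrightarrow> (\<exists>b\<in>T. val_at i g = val_at i b)"
    by (elim exE conjE)
  have "f \<in> A.span {f}"
    by (simp add: A.span_base)
  then obtain b where "b \<in> T" "val_at i f = val_at i b"
    using T(2) \<open>f \<noteq> 0\<close> by blast
  then show ?thesis
    using T(1) by simp
qed

text \<open>This bound makes the successive approximation by leading terms in \<open>next_generators_generate\<close>
  terminate.\<close>

lemma val_at_bounded:
  assumes i: "i \<in> {1..n}" and S: "finite S" "Agr m \<subseteq> A.span S"
  shows "\<exists>N::int. \<forall>f\<in>Agr m. f \<noteq> 0 \<longrightarrow> val_at i f \<le> ereal (of_int N)"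
proof -
  from val_at_adapted[OF i S(1)] obtain T where T: "finite T"
    "\<forall>b\<in>T. \<exists>z::int. val_at i b = ereal (of_int z)"
    "\<forall>g\<in>A.span S. g \<noteq> 0 \<longrightarrow> (\<exists>b\<in>T. val_at i g = val_at i b)"
    by (elim exE conjE)
  obtain z :: "'a \<Rightarrow> int" where z: "\<And>b. b \<in> T \<Longrightarrow> val_at i b = ereal (of_int (z b))"
    using T(2) by metis
  have "val_at i f \<le> ereal (of_int (Max (z ` T)))" if f: "f \<in> Agr m" "f \<noteq> 0" for f
  proof -
    obtain b where b: "b \<in> T" "val_at i f = val_at i b"
      using T(3) subsetD[OF S(2) f(1)] f(2) by blast
    have "z b \<le> Max (z ` T)"
      using T(1) b(1) by simp
    then show ?thesis
      using b z by simp
  qed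
  then show ?thesis by blast
qed

section \<open>The Rees algebras\<close>

definition exponents :: "nat \<Rightarrow> (nat \<Rightarrow>\<^sub>0 int) set" where
  "exponents j = {r. Poly_Mapping.keys r \<subseteq> {1..j}}"

lemma rees_iff: "p \<in> rees j \<longleftrightarrow>
    (\<forall>r. Poly_Mapping.lookup p r \<noteq> 0 \<longrightarrow> r \<in> exponents j) \<and>
    (\<forall>r. Poly_Mapping.lookup p r \<noteq> 0 \<longrightarrow> Poly_Mapping.lookup p r \<in> filtration j r)"
  by (auto simp: rees_def exponents_def in_keys_iff)

lemma single_in_rees: "Poly_Mapping.single r f \<in> rees j \<longleftrightarrow> f = 0 \<or> r \<in> exponents j \<and> f \<in> filtration j r"
  by (auto simp: rees_iff lookup_single when_def)

lemma exponents_zero: "0 \<in> exponents j"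
  and exponents_add: "r \<in> exponents j \<Longrightarrow> s \<in> exponents j \<Longrightarrow> r + s \<in> exponents j"
  and exponents_single: "i \<in> {1..j} \<Longrightarrow> Poly_Mapping.single i c \<in> exponents j"
  using keys_add[of r s] by (auto simp: exponents_def)

lemma filtration_zero: "j \<le> n \<Longrightarrow> 0 \<in> filtration j r"
  by (simp add: filtration_def val_at_zero)

lemma filtration_add: "j \<le> n \<Longrightarrow> f \<in> filtration j r \<Longrightarrow> g \<in> filtration j r \<Longrightarrow> f + g \<in> filtration j r"
  by (simp add: filtration_def val_at_add_ge)

lemma filtration_minus: "j \<le> n \<Longrightarrow> f \<in> filtration j r \<Longrightarrow> - f \<in> filtration j r"
  by (simp add: filtration_def val_at_minus)

lemma filtration_mult:
  "j \<le> n \<Longrightarrow> f \<in> filtration j r \<Longrightarrow> g \<in> filtration j s \<Longrightarrow> f * g \<in> filtration j (r + s)"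
  by (simp add: filtration_def val_at_mult lookup_add add_mono flip: plus_ereal.simps(1))

lemma rees_lookup: "j \<le> n \<Longrightarrow> p \<in> rees j \<Longrightarrow> Poly_Mapping.lookup p r \<in> filtration j r"
  by (cases "Poly_Mapping.lookup p r = 0") (auto simp: rees_iff filtration_zero)

lemma rees_exponents: "p \<in> rees j \<Longrightarrow> r \<in> Poly_Mapping.keys p \<Longrightarrow> r \<in> exponents j"
  by (simp add: rees_iff in_keys_iff)

lemma rees_zero: "0 \<in> rees j"
  by (simp add: rees_iff)

lemma rees_add: "j \<le> n \<Longrightarrow> p \<in> rees j \<Longrightarrow> q \<in> rees j \<Longrightarrow> p + q \<in> rees j"
  by (auto simp: rees_lookup filtration_add rees_iff[of "p + q"] lookup_add) (metis add_0 rees_iff)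

lemma rees_minus: "j \<le> n \<Longrightarrow> p \<in> rees j \<Longrightarrow> - p \<in> rees j"
  by (auto simp: rees_iff filtration_minus)

lemma rees_sum: "j \<le> n \<Longrightarrow> (\<And>x. x \<in> I \<Longrightarrow> f x \<in> rees j) \<Longrightarrow> sum f I \<in> rees j"
  by (rule sum_closed) (auto intro: rees_zero rees_add)

lemma rees_mult: 
  assumes "j \<le> n" "p \<in> rees j" "q \<in> rees j" shows "p * q \<in> rees j"
  unfolding mult_sum_single[of p q]
  by (intro rees_sum assms(1))
    (use assms in \<open>simp add: single_in_rees rees_lookup rees_exponents exponents_add filtration_mult\<close>)

lemma rees_scalars: "j \<le> n \<Longrightarrow> A.scalars \<subseteq> rees j"
proof -
  assume j: "j \<le> n"
  have "scaleA c 1 \<in> filtration j 0" for c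
    using j val_at_scalar[of _ c] val_at_zero by (cases "c = 0") (auto simp: filtration_def)
  then show ?thesis
    by (auto simp: A.scalars_def single_in_rees exponents_zero)
qed

lemma rees_alg_gen: "j \<le> n \<Longrightarrow> B \<subseteq> rees j \<Longrightarrow> alg_gen A.scalars B \<subseteq> rees j"
  using rees_scalars[of j] A.one_scalar
  by (intro alg_gen_least) (auto intro: rees_minus rees_add rees_mult)

section \<open>The extended valuation\<close>

lemma val_ext_ge_iff:
  assumes "i \<in> {1..n}" shows "c \<le> val_ext i p \<longleftrightarrow> (\<forall>r. c \<le> val_at i (Poly_Mapping.lookup p r))"
  unfolding val_ext_def le_INF_iff
  by (metis assms ereal_less_eq(1) in_keys_iff val_at_zero)

lemma val_ext_le: "i \<in> {1..n} \<Longrightarrow> val_ext i p \<le> val_at i (Poly_Mapping.lookup p r)"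
  using val_ext_ge_iff[of i "val_ext i p" p] by simp

lemma val_ext_single: "i \<in> {1..n} \<Longrightarrow> val_ext i (Poly_Mapping.single r f) = val_at i f"
  by (simp add: val_ext_def val_at_zero top_ereal_def)

lemma val_ext_zero: "val_ext i 0 = \<infinity>"
  by (simp add: val_ext_def top_ereal_def)

lemma val_ext_attained:
  assumes "p \<noteq> 0" shows "\<exists>r\<in>Poly_Mapping.keys p. val_ext i p = val_at i (Poly_Mapping.lookup p r)"
proof -
  have "(INF r\<in>Poly_Mapping.keys p. val_at i (Poly_Mapping.lookup p r)) \<in> (\<lambda>r. val_at i (Poly_Mapping.lookup p r)) ` Poly_Mapping.keys p"
    using assms by (simp add: Min_Inf[symmetric] del: Min_Inf)
  then show ?thesis
    by (auto simp: val_ext_def)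
qed

lemma val_ext_int:
  assumes "i \<in> {1..n}" "p \<noteq> 0" shows "\<exists>z::int. val_ext i p = ereal (of_int z)"
  using val_ext_attained[OF assms(2), of i] val_at_int[OF assms(1)] by (metis in_keys_iff)

text \<open>The order on exponents is the lexicographic one, which is compatible with addition; the first
  exponent of minimal value serves Gauss's lemma.\<close>

lemma val_ext_first_key:
  assumes "i \<in> {1..n}" "p \<noteq> 0"
  obtains r where "val_at i (Poly_Mapping.lookup p r) = val_ext i p"
    "\<And>s. s < r \<Longrightarrow> val_ext i p < val_at i (Poly_Mapping.lookup p s)"
proof -
  let ?M = "{r\<in>Poly_Mapping.keys p. val_at i (Poly_Mapping.lookup p r) = val_ext i p}"
  have M: "finite ?M" "?M \<noteq> {}"
    using val_ext_attained[OF assms(2), of i] by auto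
  show ?thesis
  proof (rule that[of "Min ?M"])
    show "val_at i (Poly_Mapping.lookup p (Min ?M)) = val_ext i p"
      using Min_in[OF M] by simp
    fix s assume "s < Min ?M"
    then have "s \<notin> ?M"
      using Min_le[OF M(1)] by (meson leD)
    moreover have "val_ext i p < \<infinity>"
      using val_ext_int[OF assms] by auto
    ultimately show "val_ext i p < val_at i (Poly_Mapping.lookup p s)"
      using val_ext_le[OF assms(1), of p s] val_at_zero[OF assms(1)]
      by (cases "s \<in> Poly_Mapping.keys p") (auto simp: in_keys_iff)
  qed
qed

lemma val_at_sum_gt:
  assumes "i \<in> {1..n}" "c < \<infinity>" "\<And>x. x \<in> I \<Longrightarrow> c < val_at i (f x)"
  shows "c < val_at i (sum f I)"
proof -
  have "sum f I \<in> {x. c < val_at i x}"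
    by (rule sum_closed) (use assms in \<open>simp_all add: val_at_zero val_at_add_gt\<close>)
  then show ?thesis by simp
qed

lemma val_at_sum_ge:
  assumes "i \<in> {1..n}" "\<And>x. x \<in> I \<Longrightarrow> c \<le> val_at i (f x)"
  shows "c \<le> val_at i (sum f I)"
proof -
  have "sum f I \<in> {x. c \<le> val_at i x}"
    by (rule sum_closed) (use assms in \<open>simp_all add: val_at_zero val_at_add_ge\<close>)
  then show ?thesis by simp
qed

lemma val_at_add_eq:
  assumes "i \<in> {1..n}" "val_at i f < val_at i g" shows "val_at i (f + g) = val_at i f"
  using val_at_add[OF assms(1), of f g] val_at_add[OF assms(1), of "f + g" "- g"] assms
  by (auto simp: val_at_minus min_def split: if_splits)

text \<open>Gauss's lemma. If \<open>r\<close> and \<open>s\<close> are the first exponents at which the coefficients of \<open>p\<close> and \<open>q\<close>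
  have minimal value, then in the coefficient of \<open>p * q\<close> at \<open>r + s\<close> every summand other than
  that of \<open>(r, s)\<close> involves a smaller exponent of \<open>p\<close> or of \<open>q\<close>, hence has a larger value.\<close>

lemma val_ext_mult:
  assumes i: "i \<in> {1..n}" shows "val_ext i (p * q) = val_ext i p + val_ext i q"
proof (cases "p = 0 \<or> q = 0")
  case True
  moreover have "val_ext i x + \<infinity> = \<infinity>" for x :: "'a laurent"
    using val_ext_int[OF i, of x] by (cases "x = 0") (auto simp: val_ext_zero)
  ultimately show ?thesis
    by (auto simp: val_ext_zero add.commute)
next
  case False
  then obtain c d :: int where c: "val_ext i p = ereal (of_int c)" and d: "val_ext i q = ereal (of_int d)"
    using val_ext_int[OF i] by metis
  note cd = val_ext_le[OF i, of p, unfolded c] val_ext_le[OF i, of q, unfolded d]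
  have add_gt: "ereal (of_int c) + ereal (of_int d) < a + b"
    if "ereal (of_int c) \<le> a" "ereal (of_int d) \<le> b" "ereal (of_int c) < a \<or> ereal (of_int d) < b" for a b
    using that by (cases a; cases b) auto
  obtain r where r: "val_at i (Poly_Mapping.lookup p r) = ereal (of_int c)"
    "\<And>s. s < r \<Longrightarrow> ereal (of_int c) < val_at i (Poly_Mapping.lookup p s)"
    using val_ext_first_key[OF i, of p] False c by metis
  obtain s where s: "val_at i (Poly_Mapping.lookup q s) = ereal (of_int d)"
    "\<And>r. r < s \<Longrightarrow> ereal (of_int d) < val_at i (Poly_Mapping.lookup q r)"
    using val_ext_first_key[OF i, of q] False d by metis
  let ?f = "\<lambda>(x, y). (Poly_Mapping.lookup p x * Poly_Mapping.lookup q y when x + y = r + s)"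
  let ?I = "Poly_Mapping.keys p \<times> Poly_Mapping.keys q"
  have rs: "(r, s) \<in> ?I"
    using r(1) s(1) val_at_zero[OF i] by (auto simp: in_keys_iff)
  have "Poly_Mapping.lookup (p * q) (r + s) = sum ?f ?I"
    by (simp add: lookup_mult_sum sum.cartesian_product)
  also have "\<dots> = ?f (r, s) + sum ?f (?I - {(r, s)})"
    by (rule sum.remove) (use rs in auto)
  finally have coeff: "Poly_Mapping.lookup (p * q) (r + s) = ?f (r, s) + sum ?f (?I - {(r, s)})" .
  have main: "val_at i (?f (r, s)) = ereal (of_int c) + ereal (of_int d)"
    using r(1) s(1) by (simp add: val_at_mult[OF i])
  have rest: "ereal (of_int c) + ereal (of_int d) < val_at i (sum ?f (?I - {(r, s)}))"
  proof (rule val_at_sum_gt[OF i])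
    fix z assume z: "z \<in> ?I - {(r, s)}"
    obtain x y where xy: "z = (x, y)" by (cases z)
    show "ereal (of_int c) + ereal (of_int d) < val_at i (?f z)"
    proof (cases "x + y = r + s")
      case True
      have "x < r \<or> y < s"
      proof (rule ccontr)
        assume "\<not> ?thesis"
        then have "r \<le> x" "s \<le> y" by auto
        moreover have "x \<noteq> r"
          using True z xy by auto
        ultimately have "r + s < x + y"
          by (simp add: add_less_le_mono)
        with True show False by simp
      qed
      then show ?thesis
        using True xy r(2) s(2) cd by (auto simp: val_at_mult[OF i] simp del: plus_ereal.simps intro!: add_gt)
    qed (simp add: xy val_at_zero[OF i])
  qed simp
  have "val_at i (Poly_Mapping.lookup (p * q) (r + s)) = ereal (of_int c) + ereal (of_int d)"
    unfolding coeff using val_at_add_eq[OF i, of "?f (r, s)"] main rest by simp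
  then have "val_ext i (p * q) \<le> ereal (of_int c) + ereal (of_int d)"
    using val_ext_le[OF i, of "p * q" "r + s"] by simp
  moreover have "ereal (of_int c) + ereal (of_int d) \<le> val_ext i (p * q)"
    unfolding val_ext_ge_iff[OF i] lookup_mult_sum
    by (intro allI val_at_sum_ge[OF i])
      (use cd in \<open>auto simp: when_def val_at_mult[OF i] val_at_zero[OF i] simp del: plus_ereal.simps intro!: add_mono\<close>)
  ultimately show ?thesis
    by (simp add: c d)
qed

lemma valued_algebra_rees:
  assumes "Suc j \<le> n" shows "valued_algebra A.scalars (rees j) (val_ext (Suc j))"
proof
  have i: "Suc j \<in> {1..n}"
    using assms by simp
  have "min (val_ext (Suc j) p) (val_ext (Suc j) q) \<le> val_ext (Suc j) (p + q)" for p q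
    unfolding val_ext_ge_iff[OF i] lookup_add
    using val_ext_le[OF i, of p] val_ext_le[OF i, of q] val_at_add[OF i]
    by (meson min.mono order_trans)
  moreover have "val_ext (Suc j) c = 0" if "c \<in> A.scalars" "c \<noteq> 0" for c
    using that by (auto simp: A.scalars_def val_ext_single[OF i] intro!: val_at_scalar[OF i])
  moreover have "val_ext (Suc j) p = \<infinity> \<or> (\<exists>z::int. val_ext (Suc j) p = ereal (of_int z))" for p
    using val_ext_int[OF i, of p] val_ext_zero by (cases "p = 0") auto
  ultimately show "int_valuation A.scalars (rees j) (val_ext (Suc j))"
    by (simp add: int_valuation_def val_ext_mult[OF i] val_ext_zero)
qed (use assms in \<open>simp_all add: rees_minus rees_add rees_mult rees_scalars A.one_scalar A.minus_one_scalar\<close>)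

lemma homogeneous_valuation_val_ext:
  assumes i: "i \<in> {1..n}" shows "A.homogeneous_valuation R (val_ext i)"
  unfolding A.homogeneous_valuation_def
proof (intro allI impI, elim conjE)
  fix D :: "(nat \<times> (nat \<Rightarrow>\<^sub>0 int)) set" and f :: "nat \<times> (nat \<Rightarrow>\<^sub>0 int) \<Rightarrow> 'a"
  assume D: "finite D" "\<forall>(m, r)\<in>D. f (m, r) \<in> Agr m \<and> Poly_Mapping.single r (f (m, r)) \<in> R"
  let ?p = "\<Sum>(m, r)\<in>D. Poly_Mapping.single r (f (m, r))"
  have lookup: "val_at i (Poly_Mapping.lookup ?p r) = (INF m\<in>{m. (m, r) \<in> D}. val_at i (f (m, r)))" for r
  proof -
    have fin: "finite {m. (m, r) \<in> D}"
      by (rule finite_subset[of _ "fst ` D"]) (use D(1) in \<open>force+\<close>)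
    have "Poly_Mapping.lookup ?p r = (\<Sum>x\<in>D. if snd x = r then f x else 0)"
      by (auto simp: lookup_sum lookup_single when_def case_prod_beta intro!: sum.cong)
    also have "\<dots> = (\<Sum>x\<in>{x\<in>D. snd x = r}. f x)"
      using D(1) by (simp add: sum.inter_filter)
    also have "\<dots> = (\<Sum>m\<in>{m. (m, r) \<in> D}. f (m, r))"
      by (rule sum.reindex_bij_witness[of _ "\<lambda>m. (m, r)" fst]) auto
    finally show ?thesis
      using val_at_sum[OF i fin, of "\<lambda>m. f (m, r)"] D(2) by auto
  qed
  have "c \<le> val_ext i ?p \<longleftrightarrow> c \<le> (INF (m, r)\<in>D. val_ext i (Poly_Mapping.single r (f (m, r))))" for c
    unfolding val_ext_ge_iff[OF i] lookup by (auto simp: le_INF_iff val_ext_single[OF i])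
  then show "val_ext i ?p = (INF (m, r)\<in>D. val_ext i (Poly_Mapping.single r (f (m, r))))"
    by (meson order_antisym order_refl)
qed


section \<open>Splitting off the last variable\<close>

definition truncate :: "nat \<Rightarrow> (nat \<Rightarrow>\<^sub>0 int) \<Rightarrow> nat \<Rightarrow>\<^sub>0 int" where
  "truncate j r = (\<Sum>i\<in>{1..j}. Poly_Mapping.single i (Poly_Mapping.lookup r i))"

lemma lookup_truncate: "Poly_Mapping.lookup (truncate j r) k = (if k \<in> {1..j} then Poly_Mapping.lookup r k else 0)"
  by (simp add: truncate_def lookup_sum lookup_single when_def sum.delta)

lemma truncate_add: "truncate j (r + s) = truncate j r + truncate j s"
  by (simp add: truncate_def lookup_add single_add sum.distrib)

lemma truncate_zero: "truncate j 0 = 0"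
  by (simp add: truncate_def)

lemma exponents_iff: "r \<in> exponents j \<longleftrightarrow> (\<forall>i. i \<notin> {1..j} \<longrightarrow> Poly_Mapping.lookup r i = 0)"
  by (auto simp: exponents_def in_keys_iff subset_iff)

lemma truncate_exponents: "truncate j r \<in> exponents j"
  by (simp add: exponents_iff lookup_truncate)

lemma exponents_split:
  "r \<in> exponents (Suc j) \<Longrightarrow> r = truncate j r + Poly_Mapping.single (Suc j) (Poly_Mapping.lookup r (Suc j))"
  by (rule poly_mapping_eqI) (auto simp: exponents_iff lookup_truncate lookup_add lookup_single when_def)

lemma exponents_join:
  "r \<in> exponents j \<Longrightarrow> r + Poly_Mapping.single (Suc j) c \<in> exponents (Suc j)"
  by (auto simp: exponents_iff lookup_add lookup_single when_def)

lemma filtration_truncate: "filtration j (truncate j r) = filtration j r"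
  by (auto simp: filtration_def lookup_truncate)

lemma filtration_Suc:
  "f \<in> filtration (Suc j) r \<longleftrightarrow>
     f \<in> filtration j r \<and> ereal (of_int (Poly_Mapping.lookup r (Suc j))) \<le> val_at (Suc j) f"
  by (auto simp: filtration_def atLeastAtMostSuc_conv)

lemma filtration_join:
  "f \<in> filtration (Suc j) (r + Poly_Mapping.single (Suc j) c) \<longleftrightarrow>
     f \<in> filtration j r \<and> ereal (of_int (Poly_Mapping.lookup r (Suc j) + c)) \<le> val_at (Suc j) f"
  by (auto simp: filtration_Suc filtration_def lookup_add lookup_single when_def)

lemma exponents_Suc_lookup: "r \<in> exponents j \<Longrightarrow> Poly_Mapping.lookup r (Suc j) = 0"
  by (simp add: exponents_iff)

lemma mult_tpow_in_rees:
  assumes j: "Suc j \<le> n" and p: "p \<in> rees j" "ereal (of_int c) \<le> val_ext (Suc j) p"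
  shows "p * tpow (Suc j) c \<in> rees (Suc j)"
proof -
  have "p * tpow (Suc j) c =
      (\<Sum>r\<in>Poly_Mapping.keys p. Poly_Mapping.single (r + Poly_Mapping.single (Suc j) c) (Poly_Mapping.lookup p r))"
    by (subst poly_mapping_sum_single[of p]) (simp add: tpow_def sum_distrib_right mult_single)
  also have "\<dots> \<in> rees (Suc j)"
  proof (rule rees_sum[OF j])
    fix r assume r: "r \<in> Poly_Mapping.keys p"
    have "r \<in> exponents j"
      by (rule rees_exponents[OF p(1) r])
    moreover have "Poly_Mapping.lookup p r \<in> filtration j r"
      using rees_lookup[OF _ p(1)] j by simp
    moreover have "ereal (of_int c) \<le> val_at (Suc j) (Poly_Mapping.lookup p r)"
      using j by (intro order_trans[OF p(2) val_ext_le]) simp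
    ultimately show "Poly_Mapping.single (r + Poly_Mapping.single (Suc j) c) (Poly_Mapping.lookup p r) \<in> rees (Suc j)"
      by (simp add: single_in_rees exponents_join filtration_join exponents_Suc_lookup)
  qed
  finally show ?thesis .
qed

lemma tpow_minus_one_in_rees:
  assumes "i \<in> {1..j}" "j \<le> n" shows "tpow i (- 1) \<in> rees j"
  using assms
  by (auto simp: tpow_def single_in_rees exponents_single filtration_def lookup_single when_def val_at_one)

lemma tpow_power: "tpow i z ^ k = tpow i (of_nat k * z)"
proof (induction k)
  case 0
  then show ?case by (simp add: tpow_def)
next
  case (Suc k)
  then show ?case
    by (simp add: tpow_def mult_single algebra_simps flip: single_add)
qed

lemma filtration_component:
  assumes "j \<le> n" "f \<in> filtration j r" shows "A.component m f \<in> filtration j r"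
  unfolding filtration_def
proof (intro CollectI ballI)
  fix i assume i: "i \<in> {1..j}"
  then have "ereal (of_int (Poly_Mapping.lookup r i)) \<le> val_at i f"
    using assms(2) by (simp add: filtration_def)
  also have "\<dots> \<le> val_at i (A.component m f)"
    using i assms(1) by (intro val_at_component_ge) simp
  finally show "ereal (of_int (Poly_Mapping.lookup r i)) \<le> val_at i (A.component m f)" .
qed

section \<open>The next Rees algebra is generated by the lifted Khovanskii basis\<close>

lemma next_generators_homogeneous:
  assumes "\<forall>b\<in>B. A.homogeneous b" shows "\<forall>b\<in>next_generators j B. A.homogeneous b"
proof -
  have "A.homogeneous (tpow i z)" for i z
    using A.one_in_degree_zero by (auto simp: tpow_def A.homogeneous_def)
  then show ?thesis
    using assms by (auto simp: next_generators_def A.homogeneous_mult)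
qed

text \<open>Sends \<open>h\<close> to the sum of the \<open>h c * t ^ c\<close>, where \<open>t\<close> is the variable of index \<open>Suc j\<close>. This
  identifies the filtration ring of \<open>rees j\<close> with \<open>rees (Suc j)\<close>, and it sends the leading term of
  \<open>b\<close> to the generator that the algorithm makes from \<open>b\<close>.\<close>

definition specialise :: "nat \<Rightarrow> (int \<Rightarrow>\<^sub>0 'a laurent) \<Rightarrow> 'a laurent" where
  "specialise j = subst_hom id (tpow (Suc j))"

lemma ring_map_specialise: "ring_map (specialise j)"
  unfolding specialise_def
  by (rule ring_map_subst_hom) (simp_all add: ring_map_def tpow_def single_add mult_single)

lemma specialise_single: "specialise j (Poly_Mapping.single c p) = p * tpow (Suc j) c"
  unfolding specialise_def by (subst subst_hom_single) (simp_all add: ring_map_def)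

lemma lookup_specialise:
  assumes h: "\<And>c. Poly_Mapping.lookup h c \<in> rees j" and r: "r \<in> exponents j"
  shows "Poly_Mapping.lookup (specialise j h) (r + Poly_Mapping.single (Suc j) c) =
    Poly_Mapping.lookup (Poly_Mapping.lookup h c) r"
proof -
  let ?e = "Poly_Mapping.single (Suc j)"
  have coeff: "Poly_Mapping.lookup (Poly_Mapping.lookup h d * tpow (Suc j) d) (r + ?e c) =
      (if d = c then Poly_Mapping.lookup (Poly_Mapping.lookup h c) r else 0)" for d
  proof -
    have "r + ?e c = (r + ?e (c - d)) + ?e d"
      by (simp add: add.assoc flip: single_add)
    then have *: "Poly_Mapping.lookup (Poly_Mapping.lookup h d * tpow (Suc j) d) (r + ?e c) =
        Poly_Mapping.lookup (Poly_Mapping.lookup h d) (r + ?e (c - d))"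
      unfolding tpow_def by (metis lookup_mult_single_add)
    show ?thesis
    proof (cases "d = c")
      case False
      then have "Poly_Mapping.lookup (r + ?e (c - d)) (Suc j) \<noteq> 0"
        using exponents_Suc_lookup[OF r] by (simp add: lookup_add)
      then have "r + ?e (c - d) \<notin> exponents j"
        using exponents_Suc_lookup by blast
      then have "Poly_Mapping.lookup (Poly_Mapping.lookup h d) (r + ?e (c - d)) = 0"
        using h[of d] by (auto simp: rees_iff)
      then show ?thesis
        using * False by simp
    qed (use * in simp)
  qed
  have "Poly_Mapping.lookup (specialise j h) (r + ?e c) =
      (\<Sum>d\<in>Poly_Mapping.keys h. if d = c then Poly_Mapping.lookup (Poly_Mapping.lookup h c) r else 0)"
    by (simp add: specialise_def subst_hom_def lookup_sum coeff)
  also have "\<dots> = Poly_Mapping.lookup (Poly_Mapping.lookup h c) r"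
    by (auto simp: sum.delta in_keys_iff)
  finally show ?thesis .
qed

text \<open>A homogeneous \<open>f\<close> of value \<open>c\<close> agrees modulo higher value with a polynomial in leading terms of
  elements of \<open>B\<close>. Replacing that polynomial by its homogeneous component \<open>p\<close> of the degree of \<open>f\<close>
  keeps it in the generated algebra, since the generators are homogeneous, and keeps \<open>f - p\<close> of higher
  value, since the valuation is homogeneous. Now \<open>f - p\<close> has the same degree as \<open>f\<close>, and the values
  in this degree are bounded. Multiplying by \<open>t\<^sup>-\<^sup>1\<close> brings all contributions to the wanted power
  of \<open>t\<close>.\<close>

lemma next_generators_generate:
  assumes j: "Suc j \<le> n"
    and fin_dim: "\<And>m. \<exists>S. finite S \<and> Agr m \<subseteq> A.span S"
    and hom: "\<forall>b\<in>B. A.homogeneous b"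
    and kh: "khovanskii_basis A.scalars (rees j) (val_ext (Suc j)) B"
  shows "alg_gen A.scalars (next_generators j B) = rees (Suc j)"
proof
  let ?w = "val_ext (Suc j)" and ?e = "Poly_Mapping.single (Suc j)"
  let ?S = "alg_gen A.scalars (next_generators j B)"
  have i: "Suc j \<in> {1..n}" and jn: "j \<le> n"
    using j by auto
  interpret V: valued_algebra A.scalars "rees j" ?w
    by (rule valued_algebra_rees[OF j])
  have B: "B \<subseteq> rees j"
    using kh by (simp add: khovanskii_basis_def)
  have t: "tpow (Suc j) (- 1) \<in> ?S"
    by (intro alg_gen.gen) (simp add: next_generators_def)
  show "?S \<subseteq> rees (Suc j)"
  proof (rule rees_alg_gen[OF j], rule subsetI)
    fix x assume "x \<in> next_generators j B"
    then consider b where "b \<in> B" "x = b * tpow (Suc j) \<lfloor>real_of_ereal (?w b)\<rfloor>" | "x = tpow (Suc j) (- 1)"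
      by (auto simp: next_generators_def)
    then show "x \<in> rees (Suc j)"
    proof cases
      case 1
      then show ?thesis
        using B mult_tpow_in_rees[OF j, of b] val_ext_int[OF i, of b] by (cases "b = 0") (auto simp: rees_zero)
    next
      case 2
      then show ?thesis
        using tpow_minus_one_in_rees[OF _ j] by simp
    qed
  qed
  have lift: "specialise j x \<in> ?S"
    if "x \<in> alg_gen (leading_term ?w ` A.scalars) (leading_term ?w ` B)" for x
  proof (rule alg_gen_hom[OF ring_map_specialise _ _ that])
    have "specialise j (leading_term ?w x) = x" if x: "x \<in> A.scalars" for x
      using V.w_scalar[OF x] by (cases "x = 0")
        (simp_all add: leading_term_def specialise_single tpow_def ring_mapD(4)[OF ring_map_specialise])
    then show "specialise j ` leading_term ?w ` A.scalars \<subseteq> ?S"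
      by (auto intro: alg_gen.scalar)
    show "specialise j ` leading_term ?w ` B \<subseteq> ?S"
      by (auto simp: leading_term_def specialise_single next_generators_def intro!: alg_gen.gen)
  qed
  have lower: "Poly_Mapping.single (r + ?e d) f \<in> ?S" if "Poly_Mapping.single (r + ?e c) f \<in> ?S" "d \<le> c" for r c d f
  proof -
    have "Poly_Mapping.single (r + ?e d) f = Poly_Mapping.single (r + ?e c) f * tpow (Suc j) (- 1) ^ nat (c - d)"
      using that(2) by (simp add: tpow_power) (simp add: tpow_def mult_single add.assoc flip: single_add)
    then show ?thesis
      using that(1) t by (auto intro: alg_gen.mult alg_gen_power)
  qed
  have homogeneous: "Poly_Mapping.single (r + ?e d) f \<in> ?S"
    if f: "f \<in> Agr m" "r \<in> exponents j" "f \<in> filtration j r" "ereal (of_int d) \<le> val_at (Suc j) f" for r m f d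
  proof -
    obtain N :: int where N: "g \<in> Agr m \<Longrightarrow> g \<noteq> 0 \<Longrightarrow> val_at (Suc j) g \<le> ereal (of_int N)" for g
      using fin_dim[of m] val_at_bounded[OF i] by metis
    \<comment> \<open>Subtracting a polynomial in the leading terms raises the value, which is at most \<open>N\<close>.\<close>
    have "Poly_Mapping.single (r + ?e d) f \<in> ?S"
      if "f \<in> Agr m" "f \<in> filtration j r" "ereal (of_int d) \<le> val_at (Suc j) f" for f d
      using that
    proof (induction "nat (N + 1 - d)" arbitrary: f d rule: less_induct)
      case less
      show ?case
      proof (cases "f = 0")
        case True
        then show ?thesis by (simp add: alg_gen_zero)
      next
        case False
        then obtain c :: int where c: "val_at (Suc j) f = ereal (of_int c)"
          using val_at_int[OF i] by blast
        have "d \<le> c" "c \<le> N"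
          using less.prems(3) N[OF less.prems(1) False] c by auto
        let ?h = "Poly_Mapping.single c (Poly_Mapping.single r f)"
        have rf: "Poly_Mapping.single r f \<in> rees j"
          using f(2) less.prems(2) by (simp add: single_in_rees)
        have "?h = leading_term ?w (Poly_Mapping.single r f)"
          by (simp add: leading_term_def val_ext_single[OF i] c)
        then have "?h \<in> carrier V.FR"
          using V.leading_term_FR[OF rf] by simp
        then obtain h where h: "h \<in> alg_gen (leading_term ?w ` A.scalars) (leading_term ?w ` B)"
          and diff: "?h - h \<in> V.FI"
          using kh V.khovanskii_basis_iff[OF B] by blast
        have h_rees: "Poly_Mapping.lookup h x \<in> rees j" for x
          using V.leading_terms_FR[OF B] h by (auto simp: V.carrier_FR V.level_def)
        define q where "q = Poly_Mapping.lookup (Poly_Mapping.lookup h c) r"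
        define p where "p = A.component m q"
        have "q \<in> filtration j r"
          unfolding q_def by (rule rees_lookup[OF jn h_rees])
        then have p_fil: "p \<in> filtration j r"
          unfolding p_def by (rule filtration_component[OF jn])
        have "A.laurent_component m (r + ?e c) (specialise j h) \<in> ?S"
          by (rule A.laurent_component_alg_gen[OF next_generators_homogeneous[OF hom] lift[OF h]])
        then have p_S: "Poly_Mapping.single (r + ?e c) p \<in> ?S"
          by (simp add: A.laurent_component_def lookup_specialise[OF h_rees f(2)] p_def q_def)
        have "ereal (of_int c) < ?w (Poly_Mapping.single r f - Poly_Mapping.lookup h c)"
          using diff by (auto simp: filtration_ideal_def lookup_minus elim!: allE[of _ c])
        also have "\<dots> \<le> val_at (Suc j) (f - q)"
          using val_ext_le[OF i, of "Poly_Mapping.single r f - Poly_Mapping.lookup h c" r]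
          by (simp add: lookup_minus q_def)
        also have "\<dots> \<le> val_at (Suc j) (A.component m (f - q))"
          by (rule val_at_component_ge[OF i])
        also have "A.component m (f - q) = f - p"
          using A.component_homogeneous[OF less.prems(1)] by (simp add: A.component_diff p_def)
        finally have gt: "ereal (of_int c) < val_at (Suc j) (f - p)" .
        have "Poly_Mapping.single (r + ?e (c + 1)) (f - p) \<in> ?S"
        proof (rule less.hyps)
          show "nat (N + 1 - (c + 1)) < nat (N + 1 - d)"
            using \<open>d \<le> c\<close> \<open>c \<le> N\<close> by simp
          show "f - p \<in> Agr m"
            unfolding p_def using less.prems(1) A.component_in by (rule A.subspace_diff[OF A.graded_subspace])
          show "f - p \<in> filtration j r"
            using filtration_add[OF jn less.prems(2) filtration_minus[OF jn p_fil]] by simp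
          show "ereal (of_int (c + 1)) \<le> val_at (Suc j) (f - p)"
            using gt val_at_int[OF i, of "f - p"] val_at_zero[OF i] by (cases "f - p = 0") auto
        qed
        then have "Poly_Mapping.single (r + ?e c) (f - p) \<in> ?S"
          by (rule lower) simp
        then have "Poly_Mapping.single (r + ?e c) (f - p) + Poly_Mapping.single (r + ?e c) p \<in> ?S"
          using p_S by (rule alg_gen.add)
        then have "Poly_Mapping.single (r + ?e c) f \<in> ?S"
          by (simp flip: single_add)
        then show ?thesis
          using \<open>d \<le> c\<close> by (rule lower)
      qed
    qed
    then show ?thesis
      using f by blast
  qed
  show "rees (Suc j) \<subseteq> ?S"
  proof
    fix x assume x: "x \<in> rees (Suc j)"
    have "Poly_Mapping.single r (Poly_Mapping.lookup x r) \<in> ?S" if r: "r \<in> Poly_Mapping.keys x" for r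
    proof -
      let ?f = "Poly_Mapping.lookup x r" and ?d = "Poly_Mapping.lookup r (Suc j)"
      have r_split: "r = truncate j r + ?e ?d"
        by (rule exponents_split[OF rees_exponents[OF x r]])
      have f: "?f \<in> filtration j r" "ereal (of_int ?d) \<le> val_at (Suc j) ?f"
        using rees_lookup[OF j x, of r] by (simp_all add: filtration_Suc)
      have comp: "Poly_Mapping.single r (A.component m ?f) \<in> ?S" for m
      proof (subst r_split, rule homogeneous)
        show "A.component m ?f \<in> Agr m"
          by (rule A.component_in)
        show "truncate j r \<in> exponents j"
          by (rule truncate_exponents)
        show "ereal (of_int ?d) \<le> val_at (Suc j) (A.component m ?f)"
          using f(2) val_at_component_ge[OF i] by (rule order_trans)
        show "A.component m ?f \<in> filtration j (truncate j r)"
          unfolding filtration_truncate by (rule filtration_component[OF jn f(1)])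
      qed
      have "Poly_Mapping.single r ?f =
          (\<Sum>m\<in>Poly_Mapping.keys (A.components ?f). Poly_Mapping.single r (A.component m ?f))"
        using arg_cong[OF A.sum_components[of ?f], of "Poly_Mapping.single r"] by (simp only: single_sum)
      then show ?thesis
        using comp by (simp add: alg_gen_sum)
    qed
    then show "x \<in> ?S"
      by (subst poly_mapping_sum_single[of x]) (rule alg_gen_sum)
  qed
qed


section \<open>Finite generation of the Rees algebras\<close>

text \<open>For \<open>f \<noteq> 0\<close> the largest exponent \<open>r\<close> with \<open>f\<close> in \<open>filtration n r\<close>; the other monomials of
  \<open>rees n\<close> with coefficient \<open>f\<close> arise from this one on multiplication by inverses of the variables.
  For \<open>f = 0\<close> the exponent is a dummy value.\<close>

definition max_exponent :: "'a \<Rightarrow> nat \<Rightarrow>\<^sub>0 int" where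
  "max_exponent f = (\<Sum>i\<in>{1..n}. Poly_Mapping.single i \<lfloor>real_of_ereal (val_at i f)\<rfloor>)"

lemma lookup_max_exponent:
  "Poly_Mapping.lookup (max_exponent f) i = (if i \<in> {1..n} then \<lfloor>real_of_ereal (val_at i f)\<rfloor> else 0)"
  by (simp add: max_exponent_def lookup_sum lookup_single when_def sum.delta)

lemma val_at_max_exponent:
  "i \<in> {1..n} \<Longrightarrow> f \<noteq> 0 \<Longrightarrow> val_at i f = ereal (of_int (Poly_Mapping.lookup (max_exponent f) i))"
  using val_at_int[of i f] by (auto simp: lookup_max_exponent)

lemma max_exponent_in_rees: "Poly_Mapping.single (max_exponent f) f \<in> rees n"
proof -
  have "max_exponent f \<in> exponents n"
    by (simp add: exponents_iff lookup_max_exponent)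
  moreover have "f \<in> filtration n (max_exponent f)" if "f \<noteq> 0"
    using that by (simp add: filtration_def val_at_max_exponent)
  ultimately show ?thesis
    by (auto simp: single_in_rees)
qed

lemma prod_tpow: "(\<Prod>i\<in>I. tpow i (z i)) = Poly_Mapping.single (\<Sum>i\<in>I. Poly_Mapping.single i (z i)) 1"
  by (induction I rule: infinite_finite_induct) (simp_all add: tpow_def mult_single)

lemma single_from_max_exponent:
  assumes "Poly_Mapping.single r f \<in> rees n" "f \<noteq> 0"
  shows "Poly_Mapping.single r f = Poly_Mapping.single (max_exponent f) f *
    (\<Prod>i\<in>{1..n}. tpow i (- 1) ^ nat (Poly_Mapping.lookup (max_exponent f) i - Poly_Mapping.lookup r i))"
proof -
  let ?d = "\<lambda>i. Poly_Mapping.lookup r i - Poly_Mapping.lookup (max_exponent f) i"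
  have r: "r \<in> exponents n" "f \<in> filtration n r"
    using assms by (auto simp: single_in_rees)
  have "?d i \<le> 0" if i: "i \<in> {1..n}" for i
  proof -
    have "ereal (of_int (Poly_Mapping.lookup r i)) \<le> val_at i f"
      using r(2) i by (simp add: filtration_def)
    then show ?thesis
      by (simp add: val_at_max_exponent[OF i assms(2)])
  qed
  then have "(\<Prod>i\<in>{1..n}. tpow i (- 1) ^ nat (- ?d i) :: 'a laurent) = (\<Prod>i\<in>{1..n}. tpow i (?d i))"
    by (intro prod.cong) (simp_all add: tpow_power)
  moreover have "max_exponent f + (\<Sum>i\<in>{1..n}. Poly_Mapping.single i (?d i)) = r"
    using r(1) by (intro poly_mapping_eqI)
      (auto simp: lookup_add lookup_sum lookup_single when_def sum.delta lookup_max_exponent exponents_iff)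
  ultimately show ?thesis
    by (simp add: prod_tpow mult_single)
qed

text \<open>The generating set behind a strong Khovanskii basis may be infinite, but its elements have only
  finitely many coefficients. Each generator with coefficient \<open>f \<noteq> 0\<close> is a product of the one with
  the largest possible exponent and of powers of the inverses of the variables.\<close>

lemma strong_khovanskii_basis_generators:
  assumes "strong_khovanskii_basis \<B>"
  shows "\<exists>G. finite G \<and> (\<forall>g\<in>G. \<exists>r f. g = Poly_Mapping.single r f) \<and> alg_gen A.scalars G = rees n"
proof -
  let ?T = "(\<lambda>i. tpow i (- 1)) ` {1..n}"
  obtain G0 where "finite \<B>" and G0: "\<forall>g\<in>G0. \<exists>r f. g = Poly_Mapping.single r f"
    and gen: "alg_gen (alg_gen A.scalars ?T) G0 = rees n" and \<B>: "\<B> = eval_one ` G0"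
    using assms by (auto simp: strong_khovanskii_basis_def)
  define G where "G = (\<lambda>f. Poly_Mapping.single (max_exponent f) f) ` \<B> \<union> ?T"
  have "finite G"
    using \<open>finite \<B>\<close> by (simp add: G_def)
  moreover have "\<forall>g\<in>G. \<exists>r f. g = Poly_Mapping.single r f"
    by (auto simp: G_def tpow_def)
  moreover have "alg_gen A.scalars G \<subseteq> rees n"
    by (rule rees_alg_gen) (auto simp: G_def max_exponent_in_rees tpow_minus_one_in_rees)
  moreover have "alg_gen (alg_gen A.scalars ?T) G0 \<subseteq> alg_gen A.scalars G"
  proof (rule alg_gen_minimal)
    show "alg_gen A.scalars ?T \<subseteq> alg_gen A.scalars G"
      by (rule alg_gen_mono) (simp add: G_def)
    show "G0 \<subseteq> alg_gen A.scalars G"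
    proof
      fix g assume g: "g \<in> G0"
      then obtain r f where rf: "g = Poly_Mapping.single r f"
        using G0 by blast
      show "g \<in> alg_gen A.scalars G"
      proof (cases "f = 0")
        case True
        then show ?thesis by (simp add: rf alg_gen_zero)
      next
        case False
        have "g \<in> rees n"
          using alg_gen.gen[OF g] gen by blast
        moreover have "f \<in> \<B>"
          using g False by (auto simp: \<B> rf eval_one_def intro!: image_eqI[of _ _ g])
        then have "Poly_Mapping.single (max_exponent f) f \<in> alg_gen A.scalars G"
          by (auto simp: G_def intro: alg_gen.gen)
        moreover have "tpow i (- 1) \<in> alg_gen A.scalars G" if "i \<in> {1..n}" for i
          using that by (auto simp: G_def intro: alg_gen.gen)
        ultimately show ?thesis
          using False unfolding rf
          by (subst single_from_max_exponent) (auto intro!: alg_gen.mult alg_gen_prod alg_gen_power)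
      qed
    qed
  qed
  ultimately show ?thesis
    using gen by auto
qed

text \<open>Sets the variables of index greater than \<open>j\<close> to 1.\<close>

definition drop_variables :: "nat \<Rightarrow> 'a laurent \<Rightarrow> 'a laurent" where
  "drop_variables j = subst_hom (Poly_Mapping.single 0) (\<lambda>r. Poly_Mapping.single (truncate j r) 1)"

lemma ring_map_drop_variables: "ring_map (drop_variables j)"
  unfolding drop_variables_def
  by (rule ring_map_subst_hom) (simp_all add: ring_map_single_zero truncate_zero truncate_add mult_single)

lemma drop_variables_single: "drop_variables j (Poly_Mapping.single r f) = Poly_Mapping.single (truncate j r) f"
  unfolding drop_variables_def by (simp add: subst_hom_single ring_map_single_zero mult_single)

lemma drop_variables_in_rees:
  assumes "Poly_Mapping.single r f \<in> rees k" "j \<le> k"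
  shows "drop_variables j (Poly_Mapping.single r f) \<in> rees j"
proof -
  have "filtration k r \<subseteq> filtration j r"
    using assms(2) unfolding filtration_def by fastforce
  then show ?thesis
    using assms(1) by (auto simp: drop_variables_single single_in_rees truncate_exponents filtration_truncate)
qed

text \<open>Every monomial of \<open>rees j\<close> is the image of a monomial of \<open>rees n\<close>: give the missing variables
  the largest exponents that the coefficient allows.\<close>

lemma drop_variables_generators:
  assumes j: "j \<le> n" and G: "\<forall>g\<in>G. \<exists>r f. g = Poly_Mapping.single r f" "alg_gen A.scalars G = rees n"
  shows "alg_gen A.scalars (drop_variables j ` G) = rees j"
proof
  show "alg_gen A.scalars (drop_variables j ` G) \<subseteq> rees j"
  proof (rule rees_alg_gen[OF j], rule subsetI)
    fix x assume "x \<in> drop_variables j ` G"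
    then obtain g where g: "g \<in> G" "x = drop_variables j g" by blast
    then show "x \<in> rees j"
      using G(1) alg_gen.gen[OF g(1), of A.scalars] drop_variables_in_rees[OF _ j] by (auto simp: G(2))
  qed
  show "rees j \<subseteq> alg_gen A.scalars (drop_variables j ` G)"
  proof
    fix x assume x: "x \<in> rees j"
    have "Poly_Mapping.single r (Poly_Mapping.lookup x r) \<in> alg_gen A.scalars (drop_variables j ` G)"
      if r: "r \<in> Poly_Mapping.keys x" for r
    proof -
      define f where "f = Poly_Mapping.lookup x r"
      have f: "f \<noteq> 0" "f \<in> filtration j r" "r \<in> exponents j"
        using r rees_lookup[OF j x] rees_exponents[OF x r] by (auto simp: f_def in_keys_iff)
      define r' where "r' = r + (max_exponent f - truncate j (max_exponent f))"
      have lookup: "Poly_Mapping.lookup r' i = (if i \<in> {1..j} then Poly_Mapping.lookup r i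
          else Poly_Mapping.lookup (max_exponent f) i)" for i
        using f(3) by (auto simp: r'_def lookup_add lookup_minus lookup_truncate exponents_iff)
      have "truncate j r' = r"
        using f(3) by (intro poly_mapping_eqI) (auto simp: lookup_truncate lookup exponents_iff)
      moreover have "Poly_Mapping.single r' f \<in> rees n"
      proof -
        have "r' \<in> exponents n"
          using j f(3) by (auto simp: exponents_iff lookup lookup_max_exponent)
        moreover have "ereal (of_int (Poly_Mapping.lookup r' i)) \<le> val_at i f" if i: "i \<in> {1..n}" for i
        proof (cases "i \<in> {1..j}")
          case True
          then show ?thesis
            using f(2) by (simp add: filtration_def lookup)
        next
          case False
          then show ?thesis
            using val_at_max_exponent[OF i f(1)] by (simp only: lookup if_False order_refl)
        qed
        then have "f \<in> filtration n r'"
          by (simp add: filtration_def)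
        ultimately show ?thesis
          by (simp add: single_in_rees)
      qed
      then have "drop_variables j (Poly_Mapping.single r' f) \<in> alg_gen A.scalars (drop_variables j ` G)"
        unfolding G(2)[symmetric]
      proof (rule alg_gen_hom[OF ring_map_drop_variables, rotated 2])
        show "drop_variables j ` A.scalars \<subseteq> alg_gen A.scalars (drop_variables j ` G)"
          by (auto simp: A.scalars_def drop_variables_single truncate_zero intro!: alg_gen.scalar)
        show "drop_variables j ` G \<subseteq> alg_gen A.scalars (drop_variables j ` G)"
          by (auto intro: alg_gen.gen)
      qed
      ultimately show ?thesis
        by (simp add: drop_variables_single f_def)
    qed
    then show "x \<in> alg_gen A.scalars (drop_variables j ` G)"
      by (subst poly_mapping_sum_single[of x]) (rule alg_gen_sum)
  qed
qed

text \<open>On \<open>rees (Suc j)\<close> this is the inverse of \<open>specialise j\<close>: it sorts a Laurent polynomial by powers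
  of the variable of index \<open>Suc j\<close>.\<close>

definition to_filtration :: "nat \<Rightarrow> 'a laurent \<Rightarrow> int \<Rightarrow>\<^sub>0 'a laurent" where
  "to_filtration j = subst_hom (\<lambda>f. Poly_Mapping.single 0 (Poly_Mapping.single 0 f))
     (\<lambda>r. Poly_Mapping.single (Poly_Mapping.lookup r (Suc j)) (Poly_Mapping.single (truncate j r) 1))"

lemma ring_map_double_single: "ring_map (\<lambda>f::'a. Poly_Mapping.single (0::int) (Poly_Mapping.single (0::nat \<Rightarrow>\<^sub>0 int) f))"
  by (simp add: ring_map_def single_add mult_single)

lemma ring_map_to_filtration: "ring_map (to_filtration j)"
  unfolding to_filtration_def
  by (rule ring_map_subst_hom)
    (simp_all add: ring_map_double_single truncate_zero truncate_add lookup_add mult_single)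

lemma to_filtration_single:
  "to_filtration j (Poly_Mapping.single r f) =
     Poly_Mapping.single (Poly_Mapping.lookup r (Suc j)) (Poly_Mapping.single (truncate j r) f)"
  unfolding to_filtration_def by (simp add: subst_hom_single ring_map_double_single mult_single)

text \<open>The filtration ring of \<open>rees j\<close> is a copy of \<open>rees (Suc j)\<close>. A monomial generator of the latter
  becomes \<open>b\<close> placed in some degree \<open>c\<close> not exceeding the value of \<open>b\<close>. If \<open>c\<close> equals that value, this
  is the leading term of \<open>b\<close>; otherwise it lies in the ideal that is factored out.\<close>

lemma rees_generators_khovanskii_basis:
  assumes j: "Suc j \<le> n" and G: "\<forall>g\<in>G. \<exists>r f. g = Poly_Mapping.single r f" "alg_gen A.scalars G = rees (Suc j)"
  shows "khovanskii_basis A.scalars (rees j) (val_ext (Suc j)) (drop_variables j ` G)"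
proof -
  let ?w = "val_ext (Suc j)" and ?B = "drop_variables j ` G"
  have i: "Suc j \<in> {1..n}"
    using j by auto
  interpret V: valued_algebra A.scalars "rees j" ?w
    by (rule valued_algebra_rees[OF j])
  let ?L = "alg_gen (leading_term ?w ` A.scalars) (leading_term ?w ` ?B)"
  note hom = ring_mapD[OF ring_map_to_filtration]
  have G_rees: "g \<in> rees (Suc j)" if "g \<in> G" for g
    using alg_gen.gen[OF that, of A.scalars] by (simp add: G(2))
  have B: "?B \<subseteq> rees j"
  proof
    fix b assume "b \<in> ?B"
    then obtain g where g: "g \<in> G" "b = drop_variables j g" by blast
    then show "b \<in> rees j"
      using G(1) G_rees[OF g(1)] drop_variables_in_rees[of _ _ "Suc j" j] by auto
  qed
  note L_FR = subsetD[OF V.leading_terms_FR[OF B]]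
  have FR_single: "Poly_Mapping.single c (Poly_Mapping.single r f) \<in> carrier V.FR \<longleftrightarrow>
      f = 0 \<or> r \<in> exponents j \<and> f \<in> filtration j r \<and> ereal (of_int c) \<le> val_at (Suc j) f" for c r f
  proof -
    have "Poly_Mapping.single c p \<in> carrier V.FR \<longleftrightarrow> p \<in> V.level c" for p
      by (auto simp: V.carrier_FR lookup_single when_def V.level_zero split: if_splits)
    then show ?thesis
      using val_at_zero[OF i] by (auto simp: V.level_def single_in_rees val_ext_single[OF i])
  qed
  \<comment> \<open>Every element of the filtration ring comes from the Rees algebra.\<close>
  have surj: "h \<in> to_filtration j ` rees (Suc j)" if h: "h \<in> carrier V.FR" for h
  proof -
    let ?J = "to_filtration j ` rees (Suc j)"
    have J_zero: "0 \<in> ?J"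
      using rees_zero[of "Suc j"] hom(4)[of j] by (metis imageI)
    have J_add: "x + y \<in> ?J" if "x \<in> ?J" "y \<in> ?J" for x y
    proof -
      from that obtain a b where "a \<in> rees (Suc j)" "b \<in> rees (Suc j)" "x = to_filtration j a" "y = to_filtration j b"
        by blast
      then show ?thesis
        using rees_add[OF j] by (auto intro!: image_eqI[of _ _ "a + b"] simp: hom)
    qed
    have "Poly_Mapping.single c (Poly_Mapping.single r (Poly_Mapping.lookup (Poly_Mapping.lookup h c) r)) \<in> ?J"
      for c r
    proof -
      let ?p = "Poly_Mapping.lookup h c"
      let ?f = "Poly_Mapping.lookup ?p r"
      have p: "?p \<in> rees j" "ereal (of_int c) \<le> ?w ?p"
        using h by (auto simp: V.carrier_FR V.level_def)
      show ?thesis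
      proof (cases "?f = 0")
        case True
        then show ?thesis using J_zero by simp
      next
        case False
        let ?r = "r + Poly_Mapping.single (Suc j) c"
        have r: "r \<in> exponents j"
          using p(1) False by (auto simp: rees_iff)
        have "?f \<in> filtration j r"
          using p(1) False by (auto simp: rees_iff)
        moreover have "ereal (of_int c) \<le> val_at (Suc j) ?f"
          using p(2) val_ext_le[OF i] by (rule order_trans)
        ultimately have "Poly_Mapping.single ?r ?f \<in> rees (Suc j)"
          using r by (simp add: single_in_rees exponents_join filtration_join exponents_Suc_lookup)
        moreover have "truncate j ?r = r"
          using r by (intro poly_mapping_eqI) (auto simp: lookup_truncate lookup_add lookup_single when_def exponents_iff)
        then have "to_filtration j (Poly_Mapping.single ?r ?f) = Poly_Mapping.single c (Poly_Mapping.single r ?f)"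
          using r by (simp add: to_filtration_single lookup_add exponents_Suc_lookup)
        ultimately show ?thesis
          by (metis imageI)
      qed
    qed
    then have "Poly_Mapping.single c (Poly_Mapping.lookup h c) \<in> ?J" for c
      by (subst poly_mapping_sum_single[of "Poly_Mapping.lookup h c"])
        (auto simp: single_sum intro!: sum_closed[of ?J] J_zero J_add)
    then show ?thesis
      by (subst poly_mapping_sum_single[of h]) (auto intro!: sum_closed[of ?J] J_zero J_add)
  qed
  have into: "to_filtration j x \<in> carrier V.FR" if "x \<in> rees (Suc j)" for x
  proof -
    have "to_filtration j (Poly_Mapping.single r (Poly_Mapping.lookup x r)) \<in> carrier V.FR" for r
      using rees_lookup[OF j that, of r] unfolding to_filtration_single FR_single
      by (simp add: truncate_exponents filtration_truncate filtration_Suc)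
    then have "to_filtration j (\<Sum>r\<in>Poly_Mapping.keys x. Poly_Mapping.single r (Poly_Mapping.lookup x r)) \<in> carrier V.FR"
      unfolding hom(6) by (intro sum_closed) (auto intro: V.FR_zero V.FR_add)
    then show ?thesis
      by (simp flip: poly_mapping_sum_single)
  qed
  have approx: "x \<in> rees (Suc j) \<and> (\<exists>h'\<in>?L. to_filtration j x - h' \<in> V.FI)" if "x \<in> alg_gen A.scalars G" for x
    using that
  proof induction
    case one
    then show ?case
      using rees_scalars[OF j] A.one_scalar
      by (auto simp: hom V.FI_zero intro!: bexI[of _ 1] alg_gen.one)
  next
    case (scalar x)
    have "to_filtration j x = leading_term ?w x"
      using scalar V.w_scalar[OF scalar]
      by (cases "x = 0") (auto simp: A.scalars_def to_filtration_single leading_term_def truncate_zero hom)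
    then show ?case
      using scalar rees_scalars[OF j]
      by (auto simp: V.FI_zero intro!: bexI[of _ "leading_term ?w x"] alg_gen.scalar)
  next
    case (gen g)
    then obtain r f where g: "g = Poly_Mapping.single r f"
      using G(1) by blast
    let ?c = "Poly_Mapping.lookup r (Suc j)" and ?b = "Poly_Mapping.single (truncate j r) f"
    have im: "to_filtration j g = Poly_Mapping.single ?c ?b" and b: "?b = drop_variables j g"
      by (simp_all add: g to_filtration_single drop_variables_single)
    have FR: "Poly_Mapping.single ?c ?b \<in> carrier V.FR"
      using into[OF G_rees[OF gen]] by (simp add: im)
    show ?case
    proof (cases "?w ?b = ereal (of_int ?c)")
      case True
      then have "to_filtration j g = leading_term ?w ?b"
        by (simp add: im leading_term_def)
      moreover have "leading_term ?w ?b \<in> ?L"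
        using gen by (auto simp: b intro!: alg_gen.gen)
      ultimately show ?thesis
        using G_rees[OF gen] by (auto simp: V.FI_zero intro!: bexI[of _ "leading_term ?w ?b"])
    next
      case False
      have "?b \<in> V.level ?c"
        using FR by (auto simp: V.carrier_FR elim!: allE[of _ ?c])
      then have "?b \<in> V.above ?c"
        using False by (auto simp: V.level_def V.above_def)
      then have "to_filtration j g \<in> V.FI"
        by (auto simp: im V.FI_eq lookup_single when_def V.above_zero)
      then show ?thesis
        using G_rees[OF gen] by (auto intro!: bexI[of _ 0] alg_gen_zero)
    qed
  next
    case (minus x)
    then obtain h where h: "h \<in> ?L" "to_filtration j x - h \<in> V.FI" by blast
    have "to_filtration j (- x) - (- h) \<in> V.FI"
      using V.FI_minus[OF h(2)] by (simp add: hom)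
    then show ?case
      using rees_minus[OF j] minus alg_gen.minus[OF h(1)] by blast
  next
    case (add x y)
    then obtain h k where h: "h \<in> ?L" "to_filtration j x - h \<in> V.FI"
      and k: "k \<in> ?L" "to_filtration j y - k \<in> V.FI" by blast
    have "to_filtration j (x + y) - (h + k) \<in> V.FI"
      using V.FI_add[OF h(2) k(2)] by (simp add: hom algebra_simps)
    then show ?case
      using rees_add[OF j] add alg_gen.add[OF h(1) k(1)] by blast
  next
    case (mult x y)
    then obtain h k where h: "h \<in> ?L" "to_filtration j x - h \<in> V.FI"
      and k: "k \<in> ?L" "to_filtration j y - k \<in> V.FI" by blast
    have "to_filtration j x * (to_filtration j y - k) + k * (to_filtration j x - h) \<in> V.FI"
      using mult.IH by (intro V.FI_add V.FI_mult into L_FR[OF k(1)] h(2) k(2)) blast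
    then have "to_filtration j (x * y) - h * k \<in> V.FI"
      by (simp add: hom algebra_simps)
    then show ?case
      using rees_mult[OF j] mult alg_gen.mult[OF h(1) k(1)] by blast
  qed
  show ?thesis
    unfolding V.khovanskii_basis_iff[OF B]
    using surj approx G(2) by (metis imageE)
qed

section \<open>The algorithm\<close>

lemma generators_rees_zero:
  assumes "alg_gen (range (\<lambda>c. scaleA c 1)) B0 = UNIV"
  shows "alg_gen A.scalars (Poly_Mapping.single 0 ` B0) = rees 0"
proof
  let ?S = "alg_gen A.scalars (Poly_Mapping.single 0 ` B0)"
  show "?S \<subseteq> rees 0"
    by (rule rees_alg_gen) (auto simp: single_in_rees exponents_zero filtration_def)
  have const: "Poly_Mapping.single 0 f \<in> ?S" for f
    by (rule alg_gen_hom[OF ring_map_single_zero, of "range (\<lambda>c. scaleA c 1)" _ _ B0])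
      (auto simp: assms A.scalars_eq intro: alg_gen.intros)
  show "rees 0 \<subseteq> ?S"
  proof
    fix x assume x: "x \<in> rees 0"
    have "Poly_Mapping.single r (Poly_Mapping.lookup x r) \<in> ?S" if "r \<in> Poly_Mapping.keys x" for r
      using rees_exponents[OF x that] const by (auto simp: exponents_def)
    then show "x \<in> ?S"
      by (subst poly_mapping_sum_single[of x]) (rule alg_gen_sum)
  qed
qed

definition good_generators :: "nat \<Rightarrow> 'a laurent set \<Rightarrow> bool" where
  "good_generators j B \<longleftrightarrow> finite B \<and> (\<forall>b\<in>B. A.homogeneous b) \<and> alg_gen A.scalars B = rees j"

text \<open>The subroutine only enlarges the generating set inside the algebra and respects homogeneity, so each
  of its intermediate sets again satisfies \<open>good_generators j\<close>.\<close>

lemma good_generators_subroutine: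
  assumes step: "A.khovanskii_subroutine step" and j: "Suc j \<le> n"
    and B: "good_generators j B"
    and result: "subroutine_result A.scalars step (rees j) (val_ext (Suc j)) B = Some B'"
  shows "good_generators j B'" "khovanskii_basis A.scalars (rees j) (val_ext (Suc j)) B'"
proof -
  let ?w = "val_ext (Suc j)" and ?R = "rees j"
  have i: "Suc j \<in> {1..n}" and jn: "j \<le> n"
    using j by auto
  have val: "int_valuation A.scalars ?R ?w" and hom: "A.homogeneous_valuation ?R ?w"
    using valued_algebra.valuation[OF valued_algebra_rees[OF j]] homogeneous_valuation_val_ext[OF i] by auto
  have iterate: "good_generators j ((step ?R ?w ^^ k) B)" for k
  proof (induction k)
    case 0
    then show ?case using B by simp
  next
    case (Suc k)
    let ?C = "(step ?R ?w ^^ k) B"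
    have C: "finite (step ?R ?w ?C)" "?C \<subseteq> step ?R ?w ?C" "step ?R ?w ?C \<subseteq> ?R" "\<forall>b\<in>step ?R ?w ?C. A.homogeneous b"
      using step[unfolded A.khovanskii_subroutine_def, rule_format, of ?C ?R ?w] Suc val hom
      by (auto simp: good_generators_def)
    moreover have "alg_gen A.scalars (step ?R ?w ?C) = ?R"
      using alg_gen_mono[OF C(2), of A.scalars] rees_alg_gen[OF jn C(3)] Suc by (auto simp: good_generators_def)
    ultimately show ?case
      by (simp add: good_generators_def)
  qed
  obtain k where "khovanskii_basis A.scalars ?R ?w ((step ?R ?w ^^ k) B)"
    and B': "B' = (step ?R ?w ^^ (LEAST k. khovanskii_basis A.scalars ?R ?w ((step ?R ?w ^^ k) B))) B"
    using result by (auto simp: subroutine_result_def split: if_splits)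
  then show "khovanskii_basis A.scalars ?R ?w B'"
    by (metis (mono_tags, lifting) LeastI)
  show "good_generators j B'"
    unfolding B' by (rule iterate)
qed

lemma good_generators_next:
  assumes "Suc j \<le> n" "\<And>m. \<exists>S. finite S \<and> Agr m \<subseteq> A.span S" "good_generators j B"
    "khovanskii_basis A.scalars (rees j) (val_ext (Suc j)) B"
  shows "good_generators (Suc j) (next_generators j B)"
proof -
  have B: "finite B" "\<forall>b\<in>B. A.homogeneous b"
    using assms(3) by (simp_all add: good_generators_def)
  have "finite (next_generators j B)"
    using B(1) by (simp add: next_generators_def)
  then show ?thesis
    unfolding good_generators_def
    using next_generators_homogeneous[OF B(2)] next_generators_generate[OF assms(1,2) B(2) assms(4)] by blast
qed

context
  fixes step B0
  assumes step: "A.khovanskii_subroutine step"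
    and B0: "finite B0" "alg_gen (range (\<lambda>c. scaleA c 1)) B0 = UNIV" "\<forall>b\<in>B0. \<exists>m. b \<in> Agr m"
begin

lemma algorithm_good_generators:
  "j \<le> n \<Longrightarrow> algorithm step B0 j = Some B \<Longrightarrow> good_generators j B"
proof (induction j arbitrary: B)
  case 0
  have "\<forall>b\<in>Poly_Mapping.single 0 ` B0. A.homogeneous b"
    using B0(3) unfolding A.homogeneous_def by blast
  with 0 show ?case
    using B0(1) generators_rees_zero[OF B0(2)] by (auto simp: good_generators_def)
next
  case (Suc j)
  then obtain C B' where C: "algorithm step B0 j = Some C"
    and B': "subroutine_result A.scalars step (rees j) (val_ext (Suc j)) C = Some B'"
    and B: "B = next_generators j B'"
    by (auto split: option.splits)
  have "good_generators j C"
    using Suc C by simp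
  then show ?case
    unfolding B
    by (intro good_generators_next Suc.prems A.degree_finite_dimensional[OF B0]
        good_generators_subroutine[OF step Suc.prems(1) _ B'])
qed

lemma strong_khovanskii_basis_if_stops:
  assumes "algorithm_stops step B0" shows "\<exists>\<B>. strong_khovanskii_basis \<B>"
proof -
  obtain B where "algorithm step B0 n = Some B"
    using assms by (auto simp: algorithm_stops_def)
  then have B: "finite B" "\<forall>b\<in>B. A.homogeneous b" "alg_gen A.scalars B = rees n"
    using algorithm_good_generators[of n B] by (auto simp: good_generators_def)
  let ?K = "alg_gen A.scalars ((\<lambda>i. tpow i (- 1)) ` {1..n})"
  have K: "?K \<subseteq> rees n"
    by (rule rees_alg_gen) (auto intro: tpow_minus_one_in_rees)
  have "alg_gen ?K B \<subseteq> alg_gen A.scalars B"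
    by (rule alg_gen_minimal) (use K in \<open>simp only: B(3)\<close>, auto intro: alg_gen.gen)
  moreover have "alg_gen A.scalars B \<subseteq> alg_gen ?K B"
    by (intro alg_gen_minimal) (auto intro: alg_gen.gen alg_gen.scalar)
  ultimately have "alg_gen ?K B = rees n"
    using B(3) by auto
  then have "strong_khovanskii_basis (eval_one ` B)"
    unfolding strong_khovanskii_basis_def using B(1,2)
    by (intro conjI exI[of _ B]) (simp_all add: A.homogeneous_def, blast)
  then show ?thesis ..
qed

text \<open>Round \<open>j + 1\<close> ends because the images in \<open>rees j\<close> of the finitely many monomial generators of
  \<open>rees (Suc j)\<close> form a Khovanskii basis.\<close>

lemma stops_if_strong_khovanskii_basis:
  assumes "strong_khovanskii_basis \<B>" shows "algorithm_stops step B0"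
proof -
  obtain G where G: "finite G" "\<forall>g\<in>G. \<exists>r f. g = Poly_Mapping.single r f" "alg_gen A.scalars G = rees n"
    using strong_khovanskii_basis_generators[OF assms] by blast
  have "algorithm step B0 j \<noteq> None" if "j \<le> n" for j
    using that
  proof (induction j)
    case (Suc j)
    then obtain B where B: "algorithm step B0 j = Some B"
      by auto
    then have good: "good_generators j B"
      using algorithm_good_generators Suc.prems by simp
    let ?G = "drop_variables (Suc j) ` G"
    have "khovanskii_basis A.scalars (rees j) (val_ext (Suc j)) (drop_variables j ` ?G)"
    proof (rule rees_generators_khovanskii_basis[OF Suc.prems])
      show "\<forall>g\<in>?G. \<exists>r f. g = Poly_Mapping.single r f"
        using G(2) by (metis drop_variables_single imageE)
      show "alg_gen A.scalars ?G = rees (Suc j)"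
        by (rule drop_variables_generators[OF Suc.prems G(2,3)])
    qed
    then have "\<exists>B'. finite B' \<and> khovanskii_basis A.scalars (rees j) (val_ext (Suc j)) B'"
      using G(1) by (intro exI[of _ "drop_variables j ` ?G"] conjI) simp_all
    then have "subroutine_result A.scalars step (rees j) (val_ext (Suc j)) B \<noteq> None"
      using step[unfolded A.khovanskii_subroutine_def, rule_format, of B "rees j" "val_ext (Suc j)"] good
        valued_algebra.valuation[OF valued_algebra_rees[OF Suc.prems]]
      by (simp add: good_generators_def)
    then show ?case
      using B by simp
  qed simp
  then show ?thesis
    by (simp add: algorithm_stops_def)
qed

end
end

theorem proposition5p7:
  fixes scaleQ :: "rat \<Rightarrow> 'v::ab_group_add \<Rightarrow> 'v" and N :: "'v set"
    and scaleA :: "'k::alg_closed_field \<Rightarrow> 'a::idom \<Rightarrow> 'a" and Agr :: "nat \<Rightarrow> 'a set"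
    and \<Sigma> :: "'v set set" and n :: nat and \<rho> :: "nat \<Rightarrow> 'v"
    and v :: "'a \<Rightarrow> 'v \<Rightarrow> ereal"
    and step :: "'a laurent set \<Rightarrow> ('a laurent \<Rightarrow> ereal) \<Rightarrow> 'a laurent set \<Rightarrow> 'a laurent set"
    and B0 :: "'a set"
  assumes "toric_flat_valuation scaleQ N scaleA Agr \<Sigma> n \<rho> v"
    and "graded_domain.khovanskii_subroutine scaleA Agr step"
    and "finite B0"
    and "alg_gen (range (\<lambda>c. scaleA c 1)) B0 = UNIV"
    and "\<forall>b\<in>B0. \<exists>m. b \<in> Agr m"
  shows "(\<exists>\<B>. toric_flat_valuation.strong_khovanskii_basis scaleA n \<rho> v \<B>) \<longleftrightarrow>
         toric_flat_valuation.algorithm_stops scaleA n \<rho> v step B0"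
proof -
  interpret toric_flat_valuation scaleQ N scaleA Agr \<Sigma> n \<rho> v
    by (rule assms(1))
  show ?thesis
    using strong_khovanskii_basis_if_stops[OF assms(2-5)] stops_if_strong_khovanskii_basis[OF assms(2-5)]
    by blast
qed

end
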